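(* Let $X$ be a Delone set of finite type in $\mathbb{R}^n$ with $\mathbf{0}\in X$ and $\operatorname{rank}[X]=\operatorname{rank}[X-X]=s$. Fix an address map $\phi:[X]\to\mathbb{Z}^s$. If $X$ is either linearly repetitive or densely repetitive, then there is a linear function $L:\mathbb{R}^n\to\mathbb{R}^s$ such that $$\|\phi(\mathbf{x})-L(\mathbf{x})\|=o(\|\mathbf{x}\|)\quad\text{for }\mathbf{x}\in X,\ \|\mathbf{x}\|\to\infty.$$ If $X$ is linearly repetitive, the error term can be improved to $O(\|\mathbf{x}\|^{1-\delta})$ for some $\delta=\delta(X)>0$.
   Context: A Delone set in $\mathbb{R}^n$ is a set $X\subset\mathbb{R}^n$ for which there are $r,R>0$ such that each open ball of radius $r$ contains at most one point of $X$ and each closed ball of radius $R$ contains at least one point of $X$. $X$ is of finite type if $X-X=\{\mathbf{x}-\mathbf{y}:\mathbf{x},\mathbf{y}\in X\}$ meets every bounded set in a finite set. For $A\subset\mathbb{R}^n$, $[A]$ is the additive subgroup of $\mathbb{R}^n$ generated by $A$. For a Delone set of finite type, $[X]$ is a finitely generated free abelian group; if its rank is $s$, an address map $\phi:[X]\to\mathbb{Z}^s$ is the isomorphism determined by a chosen $\mathbb{Z}$-basis $\{\mathbf{y}_1,\dots,\mathbf{y}_s\}$ of $[X]$: $\phi(n_1\mathbf{y}_1+\cdots+n_s\mathbf{y}_s)=(n_1,\dots,n_s)$. Norms are Euclidean. $B(\mathbf{x};T)$ is the closed ball of radius $T$ centered at $\mathbf{x}$. $N_X(T)$ is the number of distinct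 sets $(X\cap B(\mathbf{x};T))-\mathbf{x}$, $\mathbf{x}\in X$. $X$ is repetitive if for each $T>0$ there is a finite $M>0$ such that every closed ball of radius $M$ in $\mathbb{R}^n$ contains, for every $\mathbf{y}\in X$, some $\mathbf{x}\in X$ with $(X\cap B(\mathbf{x};T))-\mathbf{x}=(X\cap B(\mathbf{y};T))-\mathbf{y}$; $M_X(T)$ denotes the least such $M$. A repetitive $X$ is linearly repetitive if $M_X(T)=O(T)$ as $T\to\infty$, and densely repetitive if $M_X(T)=O(N_X(T)^{1/n})$ as $T\to\infty$. *)

theory Defs
  imports
    "HOL-Analysis.Analysis"
    "HOL-Library.Landau_Symbols"
    "HOL-Computational_Algebra.Group_Closure"
begin

section \<open>Delone sets of finite type\<close>

definition delone :: "(real ^ 'n) set \<Rightarrow> bool" where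
  "delone X \<longleftrightarrow> (\<exists>r R. r > 0 \<and> R > 0 \<and>
     (\<forall>c. \<forall>x \<in> X \<inter> ball c r. \<forall>y \<in> X \<inter> ball c r. x = y) \<and>
     (\<forall>c. X \<inter> cball c R \<noteq> {}))"

definition difference_set :: "(real ^ 'n) set \<Rightarrow> (real ^ 'n) set" where
  "difference_set X = {x - y | x y. x \<in> X \<and> y \<in> X}"

definition finite_type :: "(real ^ 'n) set \<Rightarrow> bool" where
  "finite_type X \<longleftrightarrow> (\<forall>B. bounded B \<longrightarrow> finite (difference_set X \<inter> B))"

section \<open>Integer bases, rank and address maps\<close>

text \<open>
  A real vector space is a module over the integers, so the library notions of span and
  independence for modules apply. The constant below keeps the simplification rules of the
  interpretation apart from those for real scalar multiplication.
\<close>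

definition int_scale :: "int \<Rightarrow> 'a::real_vector \<Rightarrow> 'a" where
  "int_scale k x = of_int k *\<^sub>R x"

global_interpretation int_module: module "int_scale :: int \<Rightarrow> 'a::real_vector \<Rightarrow> 'a"
  by standard (simp_all add: int_scale_def algebra_simps)

definition int_basis :: "'a::real_vector set \<Rightarrow> 'a set \<Rightarrow> bool" where
  "int_basis B G \<longleftrightarrow> int_module.independent B \<and> int_module.span B = G"

text \<open>The group \<open>G\<close> is free abelian of finite rank \<open>s\<close>.\<close>

definition has_int_rank :: "'a::real_vector set \<Rightarrow> nat \<Rightarrow> bool" where
  "has_int_rank G s \<longleftrightarrow> (\<exists>B. finite B \<and> card B = s \<and> int_basis B G)"

text \<open>Only the values of \<open>\<phi>\<close> on \<open>G\<close> are constrained.\<close>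

definition address_map :: "(real ^ 'n) set \<Rightarrow> (real ^ 'n \<Rightarrow> int ^ 's) \<Rightarrow> bool" where
  "address_map G \<phi> \<longleftrightarrow> (\<exists>y :: 's \<Rightarrow> real ^ 'n. inj y \<and> int_basis (range y) G \<and>
     (\<forall>m :: int ^ 's. \<phi> (\<Sum>i\<in>UNIV. int_scale (m $ i) (y i)) = m))"

definition real_of_int_vec :: "int ^ 's \<Rightarrow> real ^ 's" where
  "real_of_int_vec m = (\<chi> i. real_of_int (m $ i))"

section \<open>Patches and repetitivity\<close>

definition patch :: "(real ^ 'n) set \<Rightarrow> real \<Rightarrow> real ^ 'n \<Rightarrow> (real ^ 'n) set" where
  "patch X T x = (\<lambda>z. z - x) ` (X \<inter> cball x T)"

text \<open>
  For \<open>X\<close> of finite type there are only finitely many patches of each radius, so that \<open>card\<close>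
  is the true number of patches.
\<close>

definition patch_count :: "(real ^ 'n) set \<Rightarrow> real \<Rightarrow> nat" where
  "patch_count X T = card (patch X T ` X)"

definition repetition_radius :: "(real ^ 'n) set \<Rightarrow> real \<Rightarrow> real \<Rightarrow> bool" where
  "repetition_radius X T M \<longleftrightarrow> M > 0 \<and>
     (\<forall>c. \<forall>y\<in>X. \<exists>x \<in> X \<inter> cball c M. patch X T x = patch X T y)"

definition repetitive :: "(real ^ 'n) set \<Rightarrow> bool" where
  "repetitive X \<longleftrightarrow> (\<forall>T>0. \<exists>M. repetition_radius X T M)"

text \<open>
  For a repetitive Delone set the least \<open>M\<close> exists: the balls are closed, \<open>X\<close> is locally finite,
  and arbitrarily small radii are impossible because \<open>X\<close> is not dense.
\<close>

definition repetitivity_function :: "(real ^ 'n) set \<Rightarrow> real \<Rightarrow> real" where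
  "repetitivity_function X T = (LEAST M. repetition_radius X T M)"

definition linearly_repetitive :: "(real ^ 'n) set \<Rightarrow> bool" where
  "linearly_repetitive X \<longleftrightarrow> repetitive X \<and>
     repetitivity_function X \<in> O[at_top](\<lambda>T. T)"

definition densely_repetitive :: "(real ^ 'n) set \<Rightarrow> bool" where
  "densely_repetitive X \<longleftrightarrow> repetitive X \<and>
     repetitivity_function X \<in>
       O[at_top](\<lambda>T. real (patch_count X T) powr (1 / real CARD('n)))"

text \<open>The regime \<open>\<parallel>x\<parallel> \<rightarrow> \<infinity>\<close> with \<open>x \<in> X\<close>.\<close>

definition at_infinity_in :: "'a::real_normed_vector set \<Rightarrow> 'a filter" where
  "at_infinity_in X = inf at_infinity (principal X)"

end

(*
  Each coordinate f of the address map is Lipschitz on X, and f x - f y depends on x - y only.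
  A McShane extension F of f to the whole space is therefore Lipschitz, and its unit increments
  D_j z = F (z + e_j) - F z are bounded, continuous and determined by the local pattern of X.

  The averages of D_j over large boxes converge uniformly to a constant a_j. Let lo, hi bound the
  averages over all boxes with sides at least T. If X is linearly repetitive, every box with sides
  comparable to K T contains in its middle a translate of one fixed T-cube, and the remainder
  dissects into boxes with sides at least T; so hi - lo shrinks by a fixed factor whenever T grows
  by a fixed factor, which gives a rate T^(-delta). If X is densely repetitive, each of the N T-patches
  occurs at least c vol / N times in every sufficiently large box, so the patch statistics of any two
  such boxes share a fixed proportion of their mass, and hi - lo again contracts up to a boundary error.

  Finally, averaging F over T-cubes turns F into a function whose unit increments are within e(T) of
  a_j, while changing it by O(T) only. Hence F x - F 0 - sum_j a_j x_j = O(T) + O(e(T)) |x|; in the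
  linearly repetitive case take T = sqrt |x|.
*)

theory Submission
  imports Defs
begin

section \<open>Averages over boxes\<close>

text \<open>Bounds on averages hold only for boxes with sides at least \<open>T\<close>, whereas
  occurrences of patches are known to be disjoint only on the scale of the separation distance. In
  the dense case the function is therefore replaced by its averages over \<open>T\<close>-cubes: the
  average bound becomes a pointwise one, small cubes around the occurrences can be used, and the
  price is a boundary term of order \<open>T / U\<close> on boxes with sides at least
  \<open>U\<close>. With N patches, each occurring at least vol / (4 M)^n times, and M^n at most K
  N, the small cubes of volume (2 a)^n carry a share of at least (a / 2)^n / K of every large box.
  Under dense repetitivity \<open>M\<close> is bounded through the patch count and not by a multiple
  of the scale, so the number of contractions between two scales is not controlled; the argument
  takes an infimum over all brackets and yields no rate. Under linear repetitivity the scale grows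
  by the fixed factor \<open>\<mu>\<close> = 4 n K + 4 while the bracket shrinks by a fixed factor
  \<open>\<theta>\<close>; the rate exponent of the averages is minus the logarithm of
  \<open>\<theta>\<close> to base \<open>\<mu>\<close>.\<close>

abbreviation vol :: "(real ^ 'n) set \<Rightarrow> real" where
  "vol \<equiv> measure lborel"

text \<open>Sides are bounded below only, so the predicate survives enlarging \<open>T\<close> and
  applies to every piece of a dissection whose sides stay above \<open>T\<close>. An upper bound
  \<open>h\<close> on averages is expressed as \<open>avg_ge (\<lambda>x. - f x) T (- h)\<close>, so
  that each improvement of a bound is proved once.\<close>

definition avg_ge :: "(real ^ 'n \<Rightarrow> real) \<Rightarrow> real \<Rightarrow> real \<Rightarrow> bool" where
  "avg_ge f T l \<longleftrightarrow> (\<forall>u v. (\<forall>i. T \<le> v $ i - u $ i) \<longrightarrow>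
     l * vol (cbox u v) \<le> integral (cbox u v) f)"

section \<open>Volumes and integrals of boxes cut by hyperplanes\<close>

lemma vol_cbox_cart:
  fixes u v :: "real ^ 'n"
  assumes "\<And>i. u $ i \<le> v $ i"
  shows "vol (cbox u v) = (\<Prod>i\<in>UNIV. v $ i - u $ i)"
proof -
  have "u \<in> cbox u v"
    using assms by (auto simp: mem_box_cart)
  then show ?thesis
    by (intro content_cbox_cart) auto
qed

lemma integral_cut:
  fixes f :: "real ^ 'n \<Rightarrow> real"
  assumes "continuous_on UNIV f" and "u $ k \<le> c" and "c \<le> v $ k"
  shows "integral (cbox u v) f =
     integral (cbox u (\<chi> i. if i = k then c else v $ i)) f +
     integral (cbox (\<chi> i. if i = k then c else u $ i) v) f"
proof -
  have 1: "cbox u v \<inter> {x. x \<bullet> axis k 1 \<le> c} = cbox u (\<chi> i. if i = k then c else v $ i)"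
    using assms(3) by (auto simp: mem_box_cart inner_axis split: if_splits) force
  have 2: "cbox u v \<inter> {x. x \<bullet> axis k 1 \<ge> c} = cbox (\<chi> i. if i = k then c else u $ i) v"
    using assms(2) by (auto simp: mem_box_cart inner_axis split: if_splits) force
  have int: "f integrable_on cbox p q" for p q
    using assms(1) continuous_on_subset integrable_continuous by blast
  have ax: "axis k (1::real) \<in> Basis"
    by (auto simp: Basis_vec_def)
  have "(f has_integral (integral (cbox u (\<chi> i. if i = k then c else v $ i)) f +
     integral (cbox (\<chi> i. if i = k then c else u $ i) v) f)) (cbox u v)"
    by (rule has_integral_split[OF _ _ ax, where c = c])
      (use 1 2 int in \<open>auto simp: has_integral_integral\<close>)
  then show ?thesis
    by (rule integral_unique)
qed

lemma vol_cut:
  fixes u v :: "real ^ 'n"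
  assumes "u $ k \<le> c" and "c \<le> v $ k"
  shows "vol (cbox u v) =
     vol (cbox u (\<chi> i. if i = k then c else v $ i)) +
     vol (cbox (\<chi> i. if i = k then c else u $ i) v)"
  using integral_cut[of "\<lambda>_. 1", OF _ assms] by simp

lemma avg_geD:
  "avg_ge f T l \<Longrightarrow> (\<And>i. T \<le> v $ i - u $ i) \<Longrightarrow> l * vol (cbox u v) \<le> integral (cbox u v) f"
  by (auto simp: avg_ge_def)

lemma avg_ge_mono:
  assumes "avg_ge f T l" "T \<le> T'" "l' \<le> l"
  shows "avg_ge f T' l'"
  unfolding avg_ge_def
proof safe
  fix u v :: "real ^ 'a"
  assume "\<forall>i. T' \<le> v $ i - u $ i"
  then have "l * vol (cbox u v) \<le> integral (cbox u v) f"
    using assms by (intro avg_geD[OF assms(1)]) (auto intro: order_trans)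
  moreover have "l' * vol (cbox u v) \<le> l * vol (cbox u v)"
    using assms(3) by (simp add: mult_right_mono)
  ultimately show "l' * vol (cbox u v) \<le> integral (cbox u v) f"
    by linarith
qed

lemma avg_ge_diff_const:
  assumes "continuous_on UNIV f"
  shows "avg_ge (\<lambda>x. f x - c) T l \<longleftrightarrow> avg_ge f T (l + c)"
proof -
  have "f integrable_on cbox p q" for p q
    using assms(1) continuous_on_subset integrable_continuous by blast
  then have *: "integral (cbox u v) (\<lambda>x. f x - c) = integral (cbox u v) f - c * vol (cbox u v)" for u v
    by (subst integral_diff) auto
  then show ?thesis
    unfolding avg_ge_def * by (simp add: algebra_simps)
qed

text \<open>Halving sides longer than \<open>2 T\<close> dissects every box into boxes of bounded eccentricity.\<close>

lemma avg_geI_bounded: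
  fixes f :: "real ^ 'n \<Rightarrow> real"
  assumes cont: "continuous_on UNIV f" and "T > 0"
    and bd: "\<And>u v. (\<And>i. T \<le> v $ i - u $ i) \<Longrightarrow> (\<And>i. v $ i - u $ i \<le> 2 * T) \<Longrightarrow>
       l * vol (cbox u v) \<le> integral (cbox u v) f"
  shows "avg_ge f T l"
proof -
  have "l * vol (cbox u v) \<le> integral (cbox u v) f"
    if "\<And>i. T \<le> v $ i - u $ i" for u v :: "real ^ 'n"
    using that
  \<comment> \<open>The measure is the volume in units of \<open>T ^ CARD('n)\<close>. Each half of
    a bisected box keeps sides at least \<open>T\<close>, hence at least one unit, so removing the
    other half lowers the rounded value strictly.\<close>
  proof (induction "nat \<lfloor>vol (cbox u v) / T ^ CARD('n)\<rfloor>" arbitrary: u v rule: less_induct)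
    case less
    have uv: "u $ i \<le> v $ i" for i
      using less.prems[of i] \<open>T > 0\<close> by linarith
    show ?case
    proof (cases "\<forall>i. v $ i - u $ i \<le> 2 * T")
      case True
      then show ?thesis using less.prems bd by blast
    next
      case False
      then obtain k where k: "v $ k - u $ k > 2 * T"
        by (auto simp: not_le)
      define c where "c = (u $ k + v $ k) / 2"
      define v' where "v' = (\<chi> i. if i = k then c else v $ i)"
      define u' where "u' = (\<chi> i. if i = k then c else u $ i)"
      have c: "u $ k \<le> c" "c \<le> v $ k"
        using uv[of k] by (auto simp: c_def)
      have v': "T \<le> v' $ i - u $ i" and u': "T \<le> v $ i - u' $ i" for i
        using less.prems[of i] k by (auto simp: u'_def v'_def c_def field_simps)
      have uv': "u $ i \<le> v' $ i" "u' $ i \<le> v $ i" for i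
        using v'[of i] u'[of i] \<open>T > 0\<close> by linarith+
      have sum: "vol (cbox u v) = vol (cbox u v') + vol (cbox u' v)"
        unfolding u'_def v'_def by (rule vol_cut[OF c])
      have ge: "vol (cbox p q) / T ^ CARD('n) \<ge> 1" if "\<And>i. T \<le> q $ i - p $ i"
        for p q :: "real ^ 'n"
      proof -
        have "p $ i \<le> q $ i" for i
          using that[of i] \<open>T > 0\<close> by linarith
        moreover have "(\<Prod>i\<in>(UNIV::'n set). T) \<le> (\<Prod>i\<in>UNIV. q $ i - p $ i)"
          using that \<open>T > 0\<close> by (intro prod_mono) auto
        ultimately show ?thesis
          using \<open>T > 0\<close> by (simp add: vol_cbox_cart)
      qed
      have sum': "vol (cbox u v) / T ^ CARD('n) =
          vol (cbox u v') / T ^ CARD('n) + vol (cbox u' v) / T ^ CARD('n)"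
        by (simp add: sum add_divide_distrib)
      have "l * vol (cbox u v') \<le> integral (cbox u v') f"
        using ge[OF v'] ge[OF u'] sum' v' by (intro less.hyps) linarith+
      moreover have "l * vol (cbox u' v) \<le> integral (cbox u' v) f"
        using ge[OF v'] ge[OF u'] sum' u' by (intro less.hyps) linarith+
      moreover have "integral (cbox u v) f = integral (cbox u v') f + integral (cbox u' v) f"
        unfolding u'_def v'_def by (rule integral_cut[OF cont c])
      ultimately show ?thesis
        by (simp add: sum distrib_left)
    qed
  qed
  then show ?thesis
    by (auto simp: avg_ge_def)
qed

text \<open>Cutting slabs off the outer box removes only boxes with all sides at least \<open>T\<close>.\<close>

lemma integral_inner_box_le:
  fixes f :: "real ^ 'n \<Rightarrow> real"
  assumes cont: "continuous_on UNIV f" and "T > 0" and avg: "avg_ge f T 0"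
    and gap: "\<And>i. u $ i + T \<le> p $ i" "\<And>i. p $ i + T \<le> q $ i" "\<And>i. q $ i + T \<le> v $ i"
  shows "integral (cbox p q) f \<le> integral (cbox u v) f"
proof -
  \<comment> \<open>Coordinates in \<open>J\<close> are already trimmed to the inner box. Trimming
    coordinate \<open>k\<close> splits off two slabs; their thickness is at least \<open>T\<close>
    by \<open>gap\<close>, and each other side is an inner or an outer one, hence also at least
    \<open>T\<close>, so their integrals are nonnegative.\<close>
  have "integral (cbox (\<chi> i. if i \<in> J then p $ i else u $ i) (\<chi> i. if i \<in> J then q $ i else v $ i)) f
      \<le> integral (cbox u v) f" if "finite J" for J
    using that
  proof induction
    case empty
    then show ?case by simp
  next
    case (insert k J)
    let ?u = "\<lambda>J. \<chi> i. if i \<in> J then p $ i else u $ i"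
    let ?v = "\<lambda>J. \<chi> i. if i \<in> J then q $ i else v $ i"
    let ?w = "\<chi> i. if i = k then q $ k else ?v J $ i"
    have gap': "u $ i + T \<le> q $ i" "p $ i + T \<le> v $ i" "u $ i + T \<le> v $ i" for i
      using gap[of i] \<open>T > 0\<close> by linarith+
    have w: "?w = ?v (insert k J)"
      by (auto simp: vec_eq_iff)
    have u: "(\<chi> i. if i = k then p $ k else ?u J $ i) = ?u (insert k J)"
      by (auto simp: vec_eq_iff)
    have kq: "?u J $ k \<le> q $ k" "q $ k \<le> ?v J $ k" "?u J $ k \<le> p $ k" "p $ k \<le> ?w $ k"
      using gap[of k] gap'[of k] \<open>T > 0\<close> insert.hyps by auto
    have "integral (cbox (?u J) (?v J)) f =
      integral (cbox (?u J) ?w) f + integral (cbox (\<chi> i. if i = k then q $ k else ?u J $ i) (?v J)) f"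
      by (rule integral_cut[OF cont kq(1,2)])
    moreover have "integral (cbox (?u J) ?w) f =
      integral (cbox (?u J) (\<chi> i. if i = k then p $ k else ?w $ i)) f
      + integral (cbox (?u (insert k J)) ?w) f"
      using integral_cut[OF cont kq(3,4)] by (simp only: u)
    moreover have "0 * vol (cbox (\<chi> i. if i = k then q $ k else ?u J $ i) (?v J))
      \<le> integral (cbox (\<chi> i. if i = k then q $ k else ?u J $ i) (?v J)) f"
      using gap gap' insert.hyps by (intro avg_geD[OF avg]) (auto simp: le_diff_eq add.commute)
    moreover have "0 * vol (cbox (?u J) (\<chi> i. if i = k then p $ k else ?w $ i))
      \<le> integral (cbox (?u J) (\<chi> i. if i = k then p $ k else ?w $ i)) f"
      using gap gap' insert.hyps by (intro avg_geD[OF avg]) (auto simp: le_diff_eq add.commute)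
    ultimately show ?case
      using insert.IH by (simp add: w)
  qed
  from this[of UNIV] show ?thesis
    by simp
qed

text \<open>A lower bound at scale \<open>T\<close> and an upper bound at scale \<open>S\<close> can
  both be tested on one cube of side \<open>max T S\<close>, so no lower bound exceeds an upper one.
  The supremum of the lower bounds over all scales separates the two families; it is the limit of
  the averages once the gap closes.\<close>

lemma avg_bounds_common_point:
  fixes f :: "real ^ 'n \<Rightarrow> real"
  assumes cont: "continuous_on UNIV f" and "T0 > 0" "avg_ge f T0 l0" "avg_ge (\<lambda>x. - f x) T0 (- h0)"
  shows "\<exists>a. \<forall>T>0. (\<forall>l. avg_ge f T l \<longrightarrow> l \<le> a) \<and> (\<forall>h. avg_ge (\<lambda>x. - f x) T (- h) \<longrightarrow> a \<le> h)"
proof -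
  have le: "l \<le> h" if "T > 0" "S > 0" "avg_ge f T l" "avg_ge (\<lambda>x. - f x) S (- h)" for T S l h
  proof -
    define v :: "real ^ 'n" where "v = (\<chi> i. max T S)"
    have pos: "vol (cbox 0 v) > 0"
      using that by (subst vol_cbox_cart) (auto simp: v_def intro!: prod_pos)
    have "l * vol (cbox 0 v) \<le> integral (cbox 0 v) f"
      by (rule avg_geD[OF that(3)]) (simp add: v_def)
    moreover have "- h * vol (cbox 0 v) \<le> integral (cbox 0 v) (\<lambda>x. - f x)"
      by (rule avg_geD[OF that(4)]) (simp add: v_def)
    ultimately have "l * vol (cbox 0 v) \<le> h * vol (cbox 0 v)"
      by simp
    then show ?thesis
      using pos by simp
  qed
  define A where "A = {l. \<exists>T>0. avg_ge f T l}"
  have "l0 \<in> A"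
    using assms by (auto simp: A_def)
  have "bdd_above A"
    using le[OF _ assms(2) _ assms(4)] by (auto simp: A_def bdd_above_def)
  then have "\<forall>T>0. (\<forall>l. avg_ge f T l \<longrightarrow> l \<le> Sup A) \<and> (\<forall>h. avg_ge (\<lambda>x. - f x) T (- h) \<longrightarrow> Sup A \<le> h)"
    using le \<open>l0 \<in> A\<close> by (auto simp: A_def intro!: cSup_upper cSup_least)
  then show ?thesis ..
qed

section \<open>Repetitive Delone sets\<close>

lemma delone_separated:
  assumes "delone X"
  shows "\<exists>r>0. \<forall>x\<in>X. \<forall>y\<in>X. x \<noteq> y \<longrightarrow> r \<le> norm (x - y)"
proof -
  obtain r where "r > 0" and r: "\<And>c x y. x \<in> X \<inter> ball c r \<Longrightarrow> y \<in> X \<inter> ball c r \<Longrightarrow> x = y"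
    using assms unfolding delone_def by metis
  have "r \<le> norm (x - y)" if "x \<in> X" "y \<in> X" "x \<noteq> y" for x y
  proof (rule ccontr)
    assume "\<not> r \<le> norm (x - y)"
    then have "x = y"
      using that \<open>r > 0\<close> by (intro r[of x x y]) (auto simp: dist_norm)
    then show False
      using that by blast
  qed
  then show ?thesis
    using \<open>r > 0\<close> by blast
qed

lemma delone_relatively_dense:
  assumes "delone X"
  shows "\<exists>R>0. \<forall>c. \<exists>x\<in>X. norm (x - c) \<le> R"
proof -
  obtain R where "R > 0" and R: "\<And>c. X \<inter> cball c R \<noteq> {}"
    using assms unfolding delone_def by metis
  have "\<exists>x\<in>X. norm (x - c) \<le> R" for c
    using R[of c] by (auto simp: dist_norm norm_minus_commute)
  then show ?thesis
    using \<open>R > 0\<close> by blast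
qed

lemma finite_type_locally_finite:
  assumes "finite_type X" and "0 \<in> X" and "bounded B"
  shows "finite (X \<inter> B)"
proof -
  have "X \<subseteq> difference_set X"
  proof
    fix x assume "x \<in> X"
    then have "x - 0 \<in> difference_set X"
      using assms(2) unfolding difference_set_def by blast
    then show "x \<in> difference_set X"
      by simp
  qed
  then have "X \<inter> B \<subseteq> difference_set X \<inter> B"
    by blast
  then show ?thesis
    using assms(1,3) unfolding finite_type_def by (meson finite_subset)
qed

lemma mem_patch_iff: "d \<in> patch X T x \<longleftrightarrow> x + d \<in> X \<and> norm d \<le> T"
  by (force simp: patch_def dist_norm norm_minus_commute)

text \<open>
  Among the finitely many occurrences of a patch in a ball around \<open>c\<close>, the one nearest to \<open>c\<close>
  serves every repetition radius, hence also their infimum.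
\<close>

lemma repetition_radius_repetitivity_function:
  fixes X :: "(real ^ 'n) set"
  assumes "delone X" "finite_type X" "0 \<in> X" "repetitive X" "T > 0"
  shows "repetition_radius X T (repetitivity_function X T)"
proof -
  define A where "A = {M. repetition_radius X T M}"
  define m where "m = Inf A"
  have ne: "A \<noteq> {}"
    using assms(4,5) by (auto simp: A_def repetitive_def)
  have bdd: "bdd_below A"
    by (rule bdd_belowI[of _ 0]) (auto simp: A_def repetition_radius_def)
  have below: "m \<le> M" if "M \<in> A" for M
    unfolding m_def using that bdd by (rule cInf_lower)
  have attained: "\<exists>x \<in> X \<inter> cball c m. patch X T x = patch X T y" if "y \<in> X" for c y
  proof -
    \<comment> \<open>One admissible radius confines the search to the finite set \<open>Z\<close>;
      an occurrence outside \<open>Z\<close> is farther than \<open>M0\<close> from \<open>c\<close>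
      and cannot beat the minimiser \<open>x\<close>.\<close>
    obtain M0 where M0: "M0 \<in> A"
      using ne by blast
    define Z where "Z = {x \<in> X \<inter> cball c M0. patch X T x = patch X T y}"
    have "finite Z"
      using finite_type_locally_finite[OF assms(2,3) bounded_cball[of c M0]]
      by (rule rev_finite_subset) (auto simp: Z_def)
    moreover have "Z \<noteq> {}"
      using M0 that by (fastforce simp: A_def repetition_radius_def Z_def)
    ultimately obtain x where x: "x \<in> Z" "\<And>z. z \<in> Z \<Longrightarrow> dist c x \<le> dist c z"
      using ex_min_if_finite[of "dist c ` Z"] by (force simp: not_less)
    have "dist c x \<le> M" if M: "M \<in> A" for M
    proof -
      obtain z where z: "z \<in> X" "dist c z \<le> M" "patch X T z = patch X T y"
        using M \<open>y \<in> X\<close> by (fastforce simp: A_def repetition_radius_def)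
      show ?thesis
      proof (cases "z \<in> Z")
        case True
        then show ?thesis
          using x(2) z(2) by fastforce
      next
        case False
        then have "dist c z > M0"
          using z by (auto simp: Z_def)
        moreover have "dist c x \<le> M0"
          using x(1) by (auto simp: Z_def)
        ultimately show ?thesis
          using z(2) by linarith
      qed
    qed
    then have "dist c x \<le> m"
      unfolding m_def using ne by (intro cInf_greatest) auto
    then show ?thesis
      using x(1) by (auto simp: Z_def)
  qed
  have "m > 0"
  proof (rule ccontr)
    assume "\<not> m > 0"
    have all: "c \<in> X" for c
    proof -
      obtain x where "x \<in> X" "dist c x \<le> m"
        using attained[OF assms(3), of c] by auto
      moreover from this have "dist c x = 0"
        using \<open>\<not> m > 0\<close> zero_le_dist[of c x] by linarith
      ultimately show ?thesis
        by simp
    qed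
    obtain r where r: "r > 0" "\<And>x y. x \<noteq> y \<Longrightarrow> r \<le> norm (x - y :: real ^ 'n)"
      using delone_separated[OF assms(1)] all by blast
    obtain i :: 'n where True
      by blast
    have "norm ((r / 2) *\<^sub>R axis i 1 - 0 :: real ^ 'n) < r"
      using r(1) by simp
    moreover have "(r / 2) *\<^sub>R axis i 1 \<noteq> (0 :: real ^ 'n)"
      using r(1) by (simp add: axis_eq_0_iff)
    ultimately show False
      using r(2)[of "(r / 2) *\<^sub>R axis i 1" 0] by linarith
  qed
  then have "repetition_radius X T m"
    using attained by (auto simp: repetition_radius_def)
  moreover have "repetitivity_function X T = m"
    unfolding repetitivity_function_def
    using \<open>repetition_radius X T m\<close> below by (intro Least_equality) (auto simp: A_def)
  ultimately show ?thesis
    by simp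
qed

lemma repetition_radiusE:
  assumes "repetition_radius X T M" "y \<in> X"
  obtains x where "x \<in> X" "norm (x - c) \<le> M" "patch X T x = patch X T y"
proof -
  obtain x where "x \<in> X \<inter> cball c M" "patch X T x = patch X T y"
    using assms unfolding repetition_radius_def by blast
  then show ?thesis
    using that by (auto simp: dist_norm norm_minus_commute)
qed

lemma linearly_repetitive_radius:
  assumes "delone X" "finite_type X" "0 \<in> X" "linearly_repetitive X"
  shows "\<exists>K>0. \<exists>T1>0. \<forall>T\<ge>T1. \<forall>c. \<forall>y\<in>X. \<exists>x\<in>X. norm (x - c) \<le> K * T \<and> patch X T x = patch X T y"
proof -
  have rep: "repetitive X" and big: "repetitivity_function X \<in> O[at_top](\<lambda>T. T)"
    using assms(4) by (auto simp: linearly_repetitive_def)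
  obtain K where "K > 0" "\<forall>\<^sub>F T in at_top. norm (repetitivity_function X T) \<le> K * norm T"
    using landau_o.bigE[OF big] by blast
  then obtain T1 where T1: "\<And>T. T \<ge> T1 \<Longrightarrow> norm (repetitivity_function X T) \<le> K * norm T"
    by (auto simp: eventually_at_top_linorder)
  have "\<exists>x\<in>X. norm (x - c) \<le> K * T \<and> patch X T x = patch X T y"
    if T: "T \<ge> max T1 1" and y: "y \<in> X" for T c y
  proof -
    have "repetition_radius X T (repetitivity_function X T)"
      using T by (intro repetition_radius_repetitivity_function assms rep) auto
    then obtain x where "x \<in> X" "norm (x - c) \<le> repetitivity_function X T" "patch X T x = patch X T y"
      by (rule repetition_radiusE[OF _ y])
    moreover have "repetitivity_function X T \<le> K * T"
      using T1[of T] T by auto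
    ultimately show ?thesis
      by (intro bexI[of _ x]) auto
  qed
  then show ?thesis
    using \<open>K > 0\<close> by (intro exI[of _ K] conjI exI[of _ "max T1 1"]) auto
qed

text \<open>Raising to the power \<open>CARD('n)\<close> removes the root. In this form the
  hypothesis says that the number of patches per volume \<open>M ^ CARD('n)\<close> is bounded
  below, which is how it is used in the contraction.\<close>

lemma densely_repetitive_radius:
  fixes X :: "(real ^ 'n) set"
  assumes "delone X" "finite_type X" "0 \<in> X" "densely_repetitive X"
  shows "\<exists>K>0. \<exists>T1>0. \<forall>T\<ge>T1. \<exists>M>0. finite (patch X T ` X) \<and>
    M ^ CARD('n) \<le> K * real (card (patch X T ` X)) \<and>
    (\<forall>c. \<forall>y\<in>X. \<exists>x\<in>X. norm (x - c) \<le> M \<and> patch X T x = patch X T y)"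
proof -
  have rep: "repetitive X"
    and big: "repetitivity_function X \<in> O[at_top](\<lambda>T. real (patch_count X T) powr (1 / real CARD('n)))"
    using assms(4) by (auto simp: densely_repetitive_def)
  obtain K where "K > 0" "\<forall>\<^sub>F T in at_top. norm (repetitivity_function X T)
      \<le> K * norm (real (patch_count X T) powr (1 / real CARD('n)))"
    using landau_o.bigE[OF big] by blast
  then obtain T1 where T1: "\<And>T. T \<ge> T1 \<Longrightarrow> norm (repetitivity_function X T)
      \<le> K * norm (real (patch_count X T) powr (1 / real CARD('n)))"
    by (auto simp: eventually_at_top_linorder)
  have "\<exists>M>0. finite (patch X T ` X) \<and>
    M ^ CARD('n) \<le> K ^ CARD('n) * real (card (patch X T ` X)) \<and>
    (\<forall>c. \<forall>y\<in>X. \<exists>x\<in>X. norm (x - c) \<le> M \<and> patch X T x = patch X T y)"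
    if T: "T \<ge> max T1 1" for T
  proof -
    define M where "M = repetitivity_function X T"
    define N where "N = real (patch_count X T)"
    have rr: "repetition_radius X T M"
      unfolding M_def using T by (intro repetition_radius_repetitivity_function assms rep) auto
    then have "M > 0"
      by (simp add: repetition_radius_def)
    have le: "M \<le> K * N powr (1 / real CARD('n))"
      using T1[of T] T by (auto simp: M_def N_def)
    \<comment> \<open>\<open>card\<close> of an infinite set is 0 and \<open>0 powr _\<close> is 0,
      so \<open>N = 0\<close> would force \<open>M \<le> 0\<close>. Positivity of \<open>N\<close>
      thus also yields finiteness of the set of patches.\<close>
    have "N > 0"
    proof (rule ccontr)
      assume "\<not> N > 0"
      then have "N = 0"
        by (simp add: N_def)
      then show False
        using le \<open>M > 0\<close> by simp
    qed
    then have fin: "finite (patch X T ` X)"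
      by (auto simp: N_def patch_count_def intro: card_ge_0_finite)
    have "M ^ CARD('n) \<le> (K * N powr (1 / real CARD('n))) ^ CARD('n)"
      using le \<open>M > 0\<close> by (intro power_mono) auto
    also have "\<dots> = K ^ CARD('n) * N"
      using \<open>N > 0\<close> by (simp add: power_mult_distrib powr_realpow[symmetric] powr_powr)
    finally have "M ^ CARD('n) \<le> K ^ CARD('n) * N" .
    moreover have "\<exists>x\<in>X. norm (x - c) \<le> M \<and> patch X T x = patch X T y" if "y \<in> X" for c y
      using repetition_radiusE[OF rr that] by metis
    ultimately show ?thesis
      using \<open>M > 0\<close> fin by (auto simp: N_def patch_count_def)
  qed
  then show ?thesis
    using \<open>K > 0\<close> by (intro exI[of _ "K ^ CARD('n)"] conjI exI[of _ "max T1 1"]) auto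
qed

section \<open>Pattern-equivariant functions\<close>

text \<open>The value at \<open>x + w\<close> is determined by a patch around \<open>x\<close>
  reaching \<open>\<rho>\<close> beyond \<open>w\<close>. Patches are centred at points of
  \<open>X\<close> only, so arbitrary positions are addressed by an offset \<open>w\<close> from
  such a point.\<close>

definition pattern_equivariant :: "(real ^ 'n) set \<Rightarrow> real \<Rightarrow> (real ^ 'n \<Rightarrow> real) \<Rightarrow> bool" where
  "pattern_equivariant X \<rho> f \<longleftrightarrow> (\<forall>x\<in>X. \<forall>x'\<in>X. \<forall>T w. patch X T x = patch X T x' \<longrightarrow>
     norm w + \<rho> \<le> T \<longrightarrow> f (x + w) = f (x' + w))"

text \<open>This is what survives on \<open>X\<close> of being the restriction of an additive
  homomorphism: increments depend on the difference vector alone.\<close>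

definition translation_coherent :: "(real ^ 'n) set \<Rightarrow> (real ^ 'n \<Rightarrow> real) \<Rightarrow> bool" where
  "translation_coherent X f \<longleftrightarrow> (\<forall>x\<in>X. \<forall>y\<in>X. \<forall>x'\<in>X. \<forall>y'\<in>X.
     x - y = x' - y' \<longrightarrow> f x - f y = f x' - f y')"

section \<open>Lipschitz bounds and extension for coherent functions\<close>

lemma translation_coherentD:
  "translation_coherent X f \<Longrightarrow> x \<in> X \<Longrightarrow> y \<in> X \<Longrightarrow> x' \<in> X \<Longrightarrow> y' \<in> X \<Longrightarrow> x - y = x' - y' \<Longrightarrow>
   f x - f y = f x' - f y'"
  unfolding translation_coherent_def by blast

text \<open>Finite type leaves finitely many difference vectors of length at most \<open>b\<close>,
  and each determines its increment. The sum of the absolute increments serves as a common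
  bound.\<close>

lemma translation_coherent_bounded_steps:
  assumes "finite_type X" and coh: "translation_coherent X f"
  shows "\<exists>c\<ge>0. \<forall>x\<in>X. \<forall>y\<in>X. norm (x - y) \<le> b \<longrightarrow> \<bar>f x - f y\<bar> \<le> c"
proof -
  define E where "E = difference_set X \<inter> cball 0 b"
  have "finite E"
    using assms(1) bounded_cball[of 0 b] unfolding finite_type_def E_def by blast
  have "\<forall>d\<in>E. \<exists>x y. x \<in> X \<and> y \<in> X \<and> d = x - y"
    by (auto simp: E_def difference_set_def)
  then obtain p q where pq: "\<And>d. d \<in> E \<Longrightarrow> p d \<in> X \<and> q d \<in> X \<and> d = p d - q d"
    by metis
  define c where "c = (\<Sum>d\<in>E. \<bar>f (p d) - f (q d)\<bar>)"
  have "\<bar>f x - f y\<bar> \<le> c" if "x \<in> X" "y \<in> X" "norm (x - y) \<le> b" for x y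
  proof -
    have d: "x - y \<in> E"
      using that by (auto simp: E_def difference_set_def)
    have "f x - f y = f (p (x - y)) - f (q (x - y))"
      using pq[OF d] that by (intro translation_coherentD[OF coh]) auto
    then show ?thesis
      using d \<open>finite E\<close> by (auto simp: c_def intro: member_le_sum)
  qed
  moreover have "c \<ge> 0"
    by (simp add: c_def sum_nonneg)
  ultimately show ?thesis
    by blast
qed

text \<open>Points of \<open>X\<close> close to the segment from \<open>x\<close> to
  \<open>y\<close> form a chain with steps of length at most \<open>2 * R + 1\<close>; the number of
  steps is at most the distance plus a constant.\<close>

lemma translation_coherent_Lipschitz:
  fixes X :: "(real ^ 'n) set"
  assumes "delone X" "finite_type X" and coh: "translation_coherent X f"
  shows "\<exists>C\<ge>0. \<forall>x\<in>X. \<forall>y\<in>X. \<bar>f x - f y\<bar> \<le> C * norm (x - y)"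
proof -
  obtain r where r: "r > 0" "\<And>x y. x \<in> X \<Longrightarrow> y \<in> X \<Longrightarrow> x \<noteq> y \<Longrightarrow> r \<le> norm (x - y)"
    using delone_separated[OF assms(1)] by blast
  obtain R where R: "R > 0" "\<And>c. \<exists>x\<in>X. norm (x - c) \<le> R"
    using delone_relatively_dense[OF assms(1)] by blast
  obtain c where c: "c \<ge> 0" "\<And>x y. x \<in> X \<Longrightarrow> y \<in> X \<Longrightarrow> norm (x - y) \<le> 2 * R + 1 \<Longrightarrow> \<bar>f x - f y\<bar> \<le> c"
    using translation_coherent_bounded_steps[OF assms(2) coh] by blast
  \<comment> \<open>\<open>p\<close> and \<open>q\<close> are ideal endpoints on the segment, which
    \<open>x\<close> and \<open>y\<close> approximate within \<open>R\<close>. Separating the two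
    prevents errors from accumulating along the chain.\<close>
  have chain: "\<bar>f x - f y\<bar> \<le> c * (real N + 1)"
    if "norm (p - q) \<le> real N" "x \<in> X" "y \<in> X" "norm (x - p) \<le> R" "norm (y - q) \<le> R" for N p q x y
    using that
  proof (induction N arbitrary: p x)
    case 0
    then have "norm (x - y) \<le> norm (x - p) + norm (y - q)"
      using norm_triangle_ineq4[of "x - p" "y - q"] by simp
    then show ?case
      using 0 R(1) c(2)[of x y] by simp
  next
    case (Suc N)
    \<comment> \<open>Moving the fraction \<open>1 / (N + 1)\<close> towards \<open>q\<close> makes
      the first piece at most 1 and leaves at most \<open>N\<close>.\<close>
    define p' where "p' = p + (1 / (real N + 1)) *\<^sub>R (q - p)"
    obtain x' where x': "x' \<in> X" "norm (x' - p') \<le> R"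
      using R(2) by blast
    have "norm (p' - p) = norm (p - q) / (real N + 1)"
      by (simp add: p'_def norm_minus_commute)
    also have "\<dots> \<le> 1"
      using Suc.prems(1) by simp
    finally have 1: "norm (p' - p) \<le> 1" .
    have "p' - q = (1 - 1 / (real N + 1)) *\<^sub>R (p - q)"
      by (simp add: p'_def algebra_simps)
    moreover have "1 - 1 / (real N + 1) = real N / (real N + 1)"
      by (simp add: field_simps)
    ultimately have "norm (p' - q) = (real N / (real N + 1)) * norm (p - q)"
      by simp
    also have "\<dots> \<le> (real N / (real N + 1)) * (real N + 1)"
      using Suc.prems(1) by (intro mult_left_mono) auto
    finally have 2: "norm (p' - q) \<le> real N"
      by simp
    have "norm (x - x') \<le> norm (x - p) + norm (p - p') + norm (p' - x')"
      using norm_triangle_ineq[of "x - p" "p - p'"] norm_triangle_ineq[of "x - p'" "p' - x'"] by simp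
    then have "norm (x - x') \<le> 2 * R + 1"
      using 1 x'(2) Suc.prems(4) by (simp add: norm_minus_commute)
    then have "\<bar>f x - f x'\<bar> \<le> c"
      using c(2) Suc.prems(2) x'(1) by blast
    moreover have "\<bar>f x' - f y\<bar> \<le> c * (real N + 1)"
      using Suc.prems x' 2 by (intro Suc.IH) auto
    ultimately show ?case
      by (simp add: algebra_simps)
  qed
  have "\<bar>f x - f y\<bar> \<le> (c * (1 + 2 / r)) * norm (x - y)" if xy: "x \<in> X" "y \<in> X" for x y
  proof (cases "x = y")
    case False
    let ?N = "nat \<lceil>norm (x - y)\<rceil>"
    have "real ?N \<le> norm (x - y) + 1" "norm (x - y) \<le> real ?N"
      by (auto simp: of_nat_ceiling)
    then have "\<bar>f x - f y\<bar> \<le> c * (real ?N + 1)"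
      using xy R(1) by (intro chain[of x y]) auto
    also have "\<dots> \<le> c * (norm (x - y) + 2)"
      using c(1) \<open>real ?N \<le> norm (x - y) + 1\<close> by (intro mult_left_mono) linarith+
    \<comment> \<open>Distinct points are at least \<open>r\<close> apart, so the additive constant
      2 is absorbed by a multiple of the distance.\<close>
    also have "\<dots> \<le> c * (norm (x - y) + 2 / r * norm (x - y))"
      using r(2)[OF xy False] r(1) c(1) by (intro mult_left_mono) (auto simp: field_simps)
    finally show ?thesis
      by (simp add: algebra_simps)
  qed simp
  then show ?thesis
    using c(1) r(1) by (intro exI[of _ "c * (1 + 2 / r)"]) auto
qed

text \<open>
  McShane extension. Taking the Lipschitz constant strictly larger than that of \<open>f\<close> confines the
  infimum to points of \<open>X\<close> near \<open>z\<close>, which is what makes the extension pattern-equivariant.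
\<close>

lemma translation_coherent_extension:
  fixes X :: "(real ^ 'n) set"
  assumes ne: "X \<noteq> {}" and R: "R > 0" "\<And>c. \<exists>x\<in>X. norm (x - c) \<le> R"
    and C: "C \<ge> 0" "\<And>x y. x \<in> X \<Longrightarrow> y \<in> X \<Longrightarrow> \<bar>f x - f y\<bar> \<le> C * norm (x - y)"
    and coh: "translation_coherent X f"
  shows "\<exists>F. (\<forall>x\<in>X. F x = f x) \<and> (\<forall>z z'. \<bar>F z - F z'\<bar> \<le> (C + 1) * norm (z - z')) \<and>
    (\<exists>\<rho>>0. \<forall>x\<in>X. \<forall>x'\<in>X. \<forall>T w. patch X T x = patch X T x' \<longrightarrow> norm w + \<rho> \<le> T \<longrightarrow>
       F (x + w) - f x = F (x' + w) - f x')"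
proof -
  define F where "F z = (INF x\<in>X. f x + (C + 1) * norm (x - z))" for z
  have low: "f x0 - C * norm (x0 - z) \<le> f x + (C + 1) * norm (x - z)" if "x0 \<in> X" "x \<in> X" for x0 x z
  proof -
    have "f x0 - f x \<le> C * norm (x0 - x)"
      using C(2)[OF that] by linarith
    also have "\<dots> \<le> C * (norm (x0 - z) + norm (x - z))"
      using C(1) norm_triangle_ineq4[of "x0 - z" "x - z"] by (intro mult_left_mono) auto
    finally show ?thesis
      using norm_ge_zero[of "x - z"] by (simp add: algebra_simps del: norm_ge_zero)
  qed
  obtain x0 where "x0 \<in> X"
    using ne by blast
  have bdd: "bdd_below ((\<lambda>x. f x + (C + 1) * norm (x - z)) ` X)" for z
    using low[OF \<open>x0 \<in> X\<close>] by (intro bdd_belowI2[where m = "f x0 - C * norm (x0 - z)"])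
  have F_le: "F z \<le> f x + (C + 1) * norm (x - z)" if "x \<in> X" for x z
    unfolding F_def using bdd that by (rule cINF_lower)
  have F_ge: "t \<le> F z" if "\<And>x. x \<in> X \<Longrightarrow> t \<le> f x + (C + 1) * norm (x - z)" for t z
    unfolding F_def using ne that by (rule cINF_greatest)
  have ext: "F x = f x" if "x \<in> X" for x
  proof (rule antisym)
    show "F x \<le> f x"
      using F_le[OF that, of x] by simp
    show "f x \<le> F x"
      using low[OF that, where z = x] by (intro F_ge) simp
  qed
  have lip1: "F z \<le> F z' + (C + 1) * norm (z - z')" for z z'
  proof -
    have "F z - (C + 1) * norm (z - z') \<le> F z'"
    proof (rule F_ge)
      fix x assume "x \<in> X"
      have "(C + 1) * norm (x - z) \<le> (C + 1) * (norm (x - z') + norm (z - z'))"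
        using C(1) norm_triangle_ineq4[of "x - z'" "z - z'"] by (intro mult_left_mono) auto
      then show "F z - (C + 1) * norm (z - z') \<le> f x + (C + 1) * norm (x - z')"
        using F_le[OF \<open>x \<in> X\<close>, of z] by (simp add: algebra_simps)
    qed
    then show ?thesis
      by linarith
  qed
  have lip: "\<bar>F z - F z'\<bar> \<le> (C + 1) * norm (z - z')" for z z'
    using lip1[of z z'] lip1[of z' z] by (auto simp: norm_minus_commute)
  \<comment> \<open>A competitor \<open>y\<close> outside the patch is at least
    \<open>\<rho>\<close> away from \<open>x + w\<close>. The surplus slope 1 then costs at least
    \<open>2 * (C + 1) * R\<close>, more than the \<open>(2 * C + 1) * R\<close> that could be
    gained over a point \<open>y0\<close> within \<open>R\<close> of \<open>x + w\<close>.\<close>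
  define \<rho> where "\<rho> = 2 * (C + 1) * R"
  have "R \<le> \<rho>" "\<rho> > 0"
    using C(1) R(1) by (auto simp: \<rho>_def algebra_simps intro!: add_pos_nonneg add_increasing2)
  have loc1: "F (x' + w) - f x' \<le> F (x + w) - f x"
    if xs: "x \<in> X" "x' \<in> X" and pt: "patch X T x = patch X T x'" and w: "norm w + \<rho> \<le> T" for x x' T w
  proof -
    \<comment> \<open>Equality of patches provides the translate \<open>x' + (y - x)\<close> of
      \<open>y\<close> as a competitor for \<open>x'\<close>, with the same increment by
      coherence.\<close>
    have near: "F (x' + w) - f x' + f x \<le> f y + (C + 1) * norm (y - (x + w))"
      if "y \<in> X" "norm (y - x) \<le> T" for y
    proof -
      have "y - x \<in> patch X T x'"
        using that xs pt by (simp add: mem_patch_iff flip: pt)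
      then have y': "x' + (y - x) \<in> X"
        by (simp add: mem_patch_iff)
      have "f (x' + (y - x)) - f x' = f y - f x"
        using that xs y' by (intro translation_coherentD[OF coh]) auto
      then show ?thesis
        using F_le[OF y', of "x' + w"] by (simp add: algebra_simps)
    qed
    have "F (x' + w) - f x' + f x \<le> F (x + w)"
    proof (rule F_ge)
      fix y assume y: "y \<in> X"
      show "F (x' + w) - f x' + f x \<le> f y + (C + 1) * norm (y - (x + w))"
      proof (cases "norm (y - x) \<le> T")
        case True
        then show ?thesis using near y by blast
      next
        case False
        obtain y0 where y0: "y0 \<in> X" "norm (y0 - (x + w)) \<le> R"
          using R(2) by blast
        have "norm (y0 - x) \<le> T"
          using norm_triangle_ineq[of "y0 - (x + w)" w] y0(2) \<open>R \<le> \<rho>\<close> w by simp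
        then have "F (x' + w) - f x' + f x \<le> f y0 + (C + 1) * norm (y0 - (x + w))"
          using near y0(1) by blast
        also have "\<dots> \<le> f y0 + (C + 1) * R"
          using y0(2) C(1) by (simp add: mult_left_mono)
        also have "\<dots> \<le> f y0 - C * R + norm (y - (x + w))"
        proof -
          have "\<rho> \<le> norm (y - (x + w))"
            using norm_triangle_ineq[of "y - (x + w)" w] False w by simp
          then show ?thesis
            using R(1) C(1) by (auto simp: \<rho>_def algebra_simps)
        qed
        also have "\<dots> \<le> f y + (C + 1) * norm (y - (x + w))"
        proof -
          have "f y0 - f y \<le> C * norm (y0 - y)"
            using C(2)[OF y0(1) y] by linarith
          also have "\<dots> \<le> C * (R + norm (y - (x + w)))"
            using C(1) norm_triangle_ineq4[of "y0 - (x + w)" "y - (x + w)"] y0(2)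
            by (intro mult_left_mono) auto
          finally show ?thesis
            by (simp add: algebra_simps)
        qed
        finally show ?thesis .
      qed
    qed
    then show ?thesis
      by linarith
  qed
  have loc: "F (x + w) - f x = F (x' + w) - f x'"
    if "x \<in> X" "x' \<in> X" "patch X T x = patch X T x'" "norm w + \<rho> \<le> T" for x x' T w
    using loc1[OF that] loc1[OF that(2,1) that(3)[symmetric] that(4)] by linarith
  show ?thesis
    using ext lip loc \<open>\<rho> > 0\<close> by blast
qed

section \<open>Convergence of averages: linear repetitivity\<close>

lemma integral_translate:
  fixes f :: "real ^ 'n \<Rightarrow> real"
  shows "integral (cbox (t + u) (t + v)) f = integral (cbox u v) (\<lambda>x. f (t + x))"
  using integral_shift_cbox_plus[of u v f t] by (simp add: o_def add.commute)

lemma continuous_integrable_cbox: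
  fixes f :: "real ^ 'n \<Rightarrow> real"
  shows "continuous_on UNIV f \<Longrightarrow> f integrable_on cbox u v"
  using continuous_on_subset integrable_continuous by blast

lemma norm_le_card_mult:
  fixes w :: "real ^ 'n"
  assumes "\<And>i. \<bar>w $ i\<bar> \<le> t"
  shows "norm w \<le> real CARD('n) * t"
proof -
  have "norm w \<le> (\<Sum>i\<in>UNIV. \<bar>w $ i\<bar>)"
    by (rule norm_le_l1_cart)
  also have "\<dots> \<le> (\<Sum>i\<in>(UNIV::'n set). t)"
    using assms by (intro sum_mono)
  finally show ?thesis
    by simp
qed

lemma avg_ge_of_lower_bound:
  fixes f :: "real ^ 'n \<Rightarrow> real"
  assumes "continuous_on UNIV f" "\<And>x. l \<le> f x"
  shows "avg_ge f T l"
  unfolding avg_ge_def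
proof safe
  fix u v :: "real ^ 'n"
  have "integral (cbox u v) (\<lambda>_. l) \<le> integral (cbox u v) f"
    using assms by (intro integral_le continuous_integrable_cbox) auto
  then show "l * vol (cbox u v) \<le> integral (cbox u v) f"
    by (simp add: mult.commute)
qed

text \<open>A copy of the cube at \<open>x0\<close> placed inside the box has average at least
  \<open>m\<close>, and the rest contributes at least \<open>l\<close>. By halving, only boxes with
  sides at most \<open>2 * (\<mu> * T)\<close> need testing; in these the cube has a volume share of
  at least \<open>(1 / (2 * \<mu>)) ^ CARD('n)\<close>, the factor of the gain.\<close>

lemma linear_improvement:
  fixes X :: "(real ^ 'n) set"
  defines "n \<equiv> real CARD('n)"
  assumes "K > 0" and lam: "\<mu> = 4 * n * K + 4"
    and rep: "\<And>S c y. S \<ge> T1 \<Longrightarrow> y \<in> X \<Longrightarrow> \<exists>x\<in>X. norm (x - c) \<le> K * S \<and> patch X S x = patch X S y"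
    and cont: "continuous_on UNIV f" and pe: "pattern_equivariant X \<rho> f"
    and T: "T > 0" "T \<ge> T1" "T \<ge> \<rho>" and "x0 \<in> X"
    and avg: "avg_ge f T l" and m: "l \<le> m" "m * T ^ CARD('n) \<le> integral (cbox x0 (x0 + vec T)) f"
  shows "avg_ge f (\<mu> * T) (l + (1 / (2 * \<mu>)) ^ CARD('n) * (m - l))"
proof (rule avg_geI_bounded[OF cont])
  have "n \<ge> 1"
    by (simp add: n_def Suc_le_eq)
  have "\<mu> > 0"
    using \<open>n \<ge> 1\<close> \<open>K > 0\<close> by (simp add: lam add_pos_pos)
  then show "\<mu> * T > 0"
    using T by simp
  fix u v :: "real ^ 'n"
  assume lo: "\<And>i. \<mu> * T \<le> v $ i - u $ i" and hi: "\<And>i. v $ i - u $ i \<le> 2 * (\<mu> * T)"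
  \<comment> \<open>Offsets within the \<open>T\<close>-cube have norm at most \<open>n * T\<close>,
    so a patch of radius \<open>S\<close> fixes \<open>f\<close> on the whole cube.\<close>
  define S where "S = n * T + \<rho>"
  have "1 * T \<le> n * T"
    using \<open>n \<ge> 1\<close> T by (intro mult_right_mono) auto
  have S: "S \<le> 2 * n * T" "T \<le> n * T"
    using \<open>1 * T \<le> n * T\<close> T mult.assoc[of 2 n T] unfolding S_def by linarith+
  define S' where "S' = max S T1"
  have "S' \<le> 2 * n * T" "S \<le> S'" "T1 \<le> S'"
    using S T mult.assoc[of 2 n T] unfolding S'_def by linarith+
  define c where "c = (1 / 2) *\<^sub>R (u + v)"
  obtain x where x: "x \<in> X" "norm (x - c) \<le> K * S'" "patch X S' x = patch X S' x0"
    using rep[OF \<open>T1 \<le> S'\<close> \<open>x0 \<in> X\<close>] by blast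
  have shift: "f (x + w) = f (x0 + w)" if "w \<in> cbox 0 (vec T)" for w
  proof -
    have "norm w \<le> n * T"
      unfolding n_def using that by (intro norm_le_card_mult) (auto simp: mem_box_cart)
    then have "norm w + \<rho> \<le> S'"
      using \<open>S \<le> S'\<close> by (simp add: S_def)
    then show ?thesis
      using pe x \<open>x0 \<in> X\<close> unfolding pattern_equivariant_def by blast
  qed
  have "integral (cbox x (x + vec T)) f = integral (cbox 0 (vec T)) (\<lambda>w. f (x + w))"
    using integral_translate[of x 0 "vec T" f] by simp
  also have "\<dots> = integral (cbox 0 (vec T)) (\<lambda>w. f (x0 + w))"
    using shift by (rule integral_cong)
  also have "\<dots> = integral (cbox x0 (x0 + vec T)) f"
    using integral_translate[of x0 0 "vec T" f] by simp
  finally have copy: "integral (cbox x (x + vec T)) f = integral (cbox x0 (x0 + vec T)) f" .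
  have "K * S' \<le> K * (2 * n * T)"
    using \<open>S' \<le> 2 * n * T\<close> \<open>K > 0\<close> by simp
  \<comment> \<open>Half a side of the box is at least \<open>2 * n * K * T + 2 * T\<close>. Beyond
    the possible displacement of \<open>x\<close> from the centre, the extra \<open>2 * T\<close> is
    room for the cube, whose lower corner is \<open>x\<close>, and for the margin \<open>T\<close>
    behind it.\<close>
  then have xc: "\<bar>x $ i - (u $ i + v $ i) / 2\<bar> \<le> 2 * n * K * T" for i
    using component_le_norm_cart[of "x - c" i] x(2) by (simp add: c_def mult_ac)
  have lamT: "\<mu> * T = 4 * n * K * T + 4 * T"
    by (simp add: lam algebra_simps)
  have le: "integral (cbox x (x + vec T)) (\<lambda>z. f z - l) \<le> integral (cbox u v) (\<lambda>z. f z - l)"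
  proof (rule integral_inner_box_le[where T = T])
    show "avg_ge (\<lambda>z. f z - l) T 0"
      using avg by (simp add: avg_ge_diff_const[OF cont])
    fix i
    show "u $ i + T \<le> x $ i" "x $ i + T \<le> (x + vec T) $ i" "(x + vec T) $ i + T \<le> v $ i"
      using xc[of i] lo[of i] T(1) unfolding lamT by (auto simp: abs_le_iff field_simps)
  qed (use cont T in \<open>auto intro!: continuous_intros\<close>)
  have diff: "integral (cbox p q) (\<lambda>z. f z - l) = integral (cbox p q) f - l * vol (cbox p q)" for p q
    using continuous_integrable_cbox[OF cont] by (subst integral_diff) auto
  have volT: "vol (cbox x (x + vec T)) = T ^ CARD('n)"
    using T by (subst vol_cbox_cart) auto
  have uv: "u $ i \<le> v $ i" for i
    using lo[of i] \<open>\<mu> * T > 0\<close> by linarith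
  have "vol (cbox u v) \<le> (\<Prod>i\<in>(UNIV::'n set). 2 * \<mu> * T)"
    using uv hi unfolding vol_cbox_cart[OF uv] by (intro prod_mono) (auto simp: mult.assoc)
  then have "vol (cbox u v) \<le> (2 * \<mu>) ^ CARD('n) * T ^ CARD('n)"
    by (simp add: power_mult_distrib)
  then have "(1 / (2 * \<mu>)) ^ CARD('n) * vol (cbox u v) \<le> T ^ CARD('n)"
    using \<open>\<mu> > 0\<close> by (simp add: power_divide field_simps)
  then have "(m - l) * ((1 / (2 * \<mu>)) ^ CARD('n) * vol (cbox u v)) \<le> (m - l) * T ^ CARD('n)"
    using m(1) by (intro mult_left_mono) auto
  also have "\<dots> \<le> integral (cbox u v) f - l * vol (cbox u v)"
    using le m(2) unfolding diff volT copy by (simp add: algebra_simps)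
  finally show "(l + (1 / (2 * \<mu>)) ^ CARD('n) * (m - l)) * vol (cbox u v) \<le> integral (cbox u v) f"
    by (simp add: algebra_simps)
qed

text \<open>The average over the cube at \<open>x0\<close> lies above or below the midpoint of the
  bracket; this decides whether \<open>lo\<close> is raised or \<open>hi\<close> is lowered, the
  latter by applying the improvement to \<open>- f\<close>. The gain is measured from the midpoint,
  hence half of the volume share.\<close>

lemma linear_contraction:
  fixes X :: "(real ^ 'n) set"
  assumes "K > 0" and lam: "\<mu> = 4 * real CARD('n) * K + 4"
    and rep: "\<And>S c y. S \<ge> T1 \<Longrightarrow> y \<in> X \<Longrightarrow> \<exists>x\<in>X. norm (x - c) \<le> K * S \<and> patch X S x = patch X S y"
    and cont: "continuous_on UNIV f" and pe: "pattern_equivariant X \<rho> f"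
    and T: "T > 0" "T \<ge> T1" "T \<ge> \<rho>" and "x0 \<in> X"
    and lo: "avg_ge f T lo" and hi: "avg_ge (\<lambda>x. - f x) T (- hi)"
  shows "\<exists>lo' hi'. hi' - lo' = (1 - (1 / (2 * \<mu>)) ^ CARD('n) / 2) * (hi - lo) \<and>
    avg_ge f (\<mu> * T) lo' \<and> avg_ge (\<lambda>x. - f x) (\<mu> * T) (- hi')"
proof -
  define \<kappa> where "\<kappa> = (1 / (2 * \<mu>)) ^ CARD('n)"
  define m where "m = (lo + hi) / 2"
  have cont': "continuous_on UNIV (\<lambda>x. - f x)"
    by (intro continuous_intros cont)
  have pe': "pattern_equivariant X \<rho> (\<lambda>x. - f x)"
    using pe unfolding pattern_equivariant_def neg_equal_iff_equal .
  have "\<mu> \<ge> 1"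
    using \<open>K > 0\<close> by (simp add: lam)
  then have mono: "T \<le> \<mu> * T"
    using mult_right_mono[of 1 \<mu> T] T by simp
  have volT: "vol (cbox x0 (x0 + vec T)) = T ^ CARD('n)"
    using T by (subst vol_cbox_cart) auto
  have "lo * T ^ CARD('n) \<le> integral (cbox x0 (x0 + vec T)) f"
    using avg_geD[OF lo, of "x0 + vec T" x0] volT by simp
  moreover have "- hi * T ^ CARD('n) \<le> - integral (cbox x0 (x0 + vec T)) f"
    using avg_geD[OF hi, of "x0 + vec T" x0] volT by simp
  ultimately have "lo * T ^ CARD('n) \<le> hi * T ^ CARD('n)"
    by simp
  then have "lo \<le> hi"
    by (rule mult_right_le_imp_le) (use T in simp)
  then have m: "lo \<le> m" "- hi \<le> - m"
    by (simp_all add: m_def)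
  show ?thesis
  proof (cases "m * T ^ CARD('n) \<le> integral (cbox x0 (x0 + vec T)) f")
    case True
    have "avg_ge f (\<mu> * T) (lo + \<kappa> * (m - lo))"
      unfolding \<kappa>_def
      by (rule linear_improvement[OF \<open>K > 0\<close> lam rep cont pe T \<open>x0 \<in> X\<close> lo m(1) True])
    moreover have "avg_ge (\<lambda>x. - f x) (\<mu> * T) (- hi)"
      using hi mono by (rule avg_ge_mono) simp
    moreover have "hi - (lo + \<kappa> * (m - lo)) = (1 - \<kappa> / 2) * (hi - lo)"
      by (simp add: m_def field_simps)
    ultimately show ?thesis
      unfolding \<kappa>_def[symmetric] by (intro exI conjI)
  next
    case False
    then have neg: "- m * T ^ CARD('n) \<le> integral (cbox x0 (x0 + vec T)) (\<lambda>x. - f x)"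
      by simp
    have "avg_ge (\<lambda>x. - f x) (\<mu> * T) (- hi + \<kappa> * (- m - (- hi)))"
      unfolding \<kappa>_def
      by (rule linear_improvement[OF \<open>K > 0\<close> lam rep cont' pe' T \<open>x0 \<in> X\<close> hi m(2) neg])
    moreover have "avg_ge f (\<mu> * T) lo"
      using lo mono by (rule avg_ge_mono) simp
    moreover have "- hi + \<kappa> * (- m - (- hi)) = - (hi - \<kappa> * (hi - m))"
      by (simp add: algebra_simps)
    moreover have "hi - \<kappa> * (hi - m) - lo = (1 - \<kappa> / 2) * (hi - lo)"
      by (simp add: m_def field_simps)
    ultimately have "avg_ge (\<lambda>x. - f x) (\<mu> * T) (- (hi - \<kappa> * (hi - m)))" "avg_ge f (\<mu> * T) lo"
      "hi - \<kappa> * (hi - m) - lo = (1 - \<kappa> / 2) * (hi - lo)"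
      by simp_all
    then show ?thesis
      unfolding \<kappa>_def[symmetric] by (intro exI conjI)
  qed
qed

definition avg_within :: "(real ^ 'n \<Rightarrow> real) \<Rightarrow> real \<Rightarrow> real \<Rightarrow> real \<Rightarrow> bool" where
  "avg_within f a T e \<longleftrightarrow> avg_ge f T (a - e) \<and> avg_ge (\<lambda>x. - f x) T (- (a + e))"

text \<open>The exponent is built from \<open>K\<close> and the dimension and is therefore bound
  before \<open>f\<close>, \<open>\<rho>\<close> and \<open>C\<close>; one exponent serves all
  coordinates and all directions.\<close>

lemma linearly_repetitive_averages:
  fixes X :: "(real ^ 'n) set"
  assumes "delone X" "finite_type X" "0 \<in> X" "linearly_repetitive X"
  shows "\<exists>\<delta>>0. \<forall>f \<rho> C. continuous_on UNIV f \<longrightarrow> pattern_equivariant X \<rho> f \<longrightarrow> (\<forall>x. \<bar>f x\<bar> \<le> C) \<longrightarrow>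
    (\<exists>a c T0. T0 > 0 \<and> (\<forall>T\<ge>T0. avg_within f a T (c * T powr (- \<delta>))))"
proof -
  obtain K T1 where "K > 0" "T1 > 0" and
    rep: "\<And>S c y. S \<ge> T1 \<Longrightarrow> y \<in> X \<Longrightarrow> \<exists>x\<in>X. norm (x - c) \<le> K * S \<and> patch X S x = patch X S y"
    using linearly_repetitive_radius[OF assms] by metis
  define \<mu> where "\<mu> = 4 * real CARD('n) * K + 4"
  define \<theta> where "\<theta> = 1 - (1 / (2 * \<mu>)) ^ CARD('n) / 2"
  define \<delta> where "\<delta> = - log \<mu> \<theta>"
  have "\<mu> \<ge> 4"
    using \<open>K > 0\<close> by (simp add: \<mu>_def)
  then have "\<mu> > 1"
    by simp
  have "(1 / (2 * \<mu>)) ^ CARD('n) \<le> 1" "(1 / (2 * \<mu>)) ^ CARD('n) > 0"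
    using \<open>\<mu> > 1\<close> by (auto intro!: power_le_one)
  then have \<theta>: "0 < \<theta>" "\<theta> < 1"
    by (auto simp: \<theta>_def)
  have "\<delta> > 0"
    using \<theta> \<open>\<mu> > 1\<close> by (simp add: \<delta>_def)
  have \<theta>_pow: "\<theta> ^ k = (\<mu> ^ k) powr (- \<delta>)" for k
  proof -
    have "\<theta> = \<mu> powr (- \<delta>)"
      using \<theta> \<open>\<mu> > 1\<close> by (simp add: \<delta>_def)
    then have "\<theta> ^ k = (\<mu> powr (- \<delta>)) ^ k"
      by simp
    also have "\<dots> = (\<mu> ^ k) powr (- \<delta>)"
      using \<open>\<mu> > 1\<close> by (simp add: powr_realpow[symmetric] powr_powr mult.commute)
    finally show ?thesis .
  qed
  have "\<exists>a c T0. T0 > 0 \<and> (\<forall>T\<ge>T0. avg_within f a T (c * T powr (- \<delta>)))"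
    if cont: "continuous_on UNIV f" and pe: "pattern_equivariant X \<rho> f" and C: "\<And>x. \<bar>f x\<bar> \<le> C" for f \<rho> C
  proof -
    \<comment> \<open>From \<open>T0\<close> on, every scale \<open>\<mu> ^ k * T0\<close> exceeds
      both the range of \<open>f\<close> and the threshold of repetitivity, as the contraction
      requires.\<close>
    define T0 where "T0 = max T1 \<rho>"
    have "T0 > 0"
      using \<open>T1 > 0\<close> by (simp add: T0_def)
    have cont': "continuous_on UNIV (\<lambda>x. - f x)"
      by (intro continuous_intros cont)
    have step: "\<exists>lo hi. hi - lo = \<theta> ^ k * (2 * C) \<and> avg_ge f (\<mu> ^ k * T0) lo
        \<and> avg_ge (\<lambda>x. - f x) (\<mu> ^ k * T0) (- hi)" for k
    proof (induction k)
      case 0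
      have "- C \<le> f x" "- C \<le> - f x" for x
        using C[of x] by auto
      then show ?case
        using cont cont' by (intro exI[of _ "- C"] exI[of _ C]) (auto intro!: avg_ge_of_lower_bound)
    next
      case (Suc k)
      then obtain lo hi where IH: "hi - lo = \<theta> ^ k * (2 * C)" "avg_ge f (\<mu> ^ k * T0) lo"
        "avg_ge (\<lambda>x. - f x) (\<mu> ^ k * T0) (- hi)"
        by blast
      have "1 * T0 \<le> \<mu> ^ k * T0"
        using \<open>T0 > 0\<close> \<open>\<mu> > 1\<close> by (intro mult_right_mono one_le_power) auto
      then have "\<mu> ^ k * T0 > 0" "T1 \<le> \<mu> ^ k * T0" "\<rho> \<le> \<mu> ^ k * T0"
        using \<open>T0 > 0\<close> by (auto simp: T0_def)
      from linear_contraction[OF \<open>K > 0\<close> \<mu>_def rep cont pe this assms(3) IH(2,3)]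
      obtain lo' hi' where "hi' - lo' = \<theta> * (hi - lo)"
        "avg_ge f (\<mu> * (\<mu> ^ k * T0)) lo'" "avg_ge (\<lambda>x. - f x) (\<mu> * (\<mu> ^ k * T0)) (- hi')"
        unfolding \<theta>_def by blast
      then show ?case
        using IH(1) by (intro exI[of _ lo'] exI[of _ hi']) (auto simp: mult_ac)
    qed
    obtain lo0 hi0 where lh0: "avg_ge f T0 lo0" "avg_ge (\<lambda>x. - f x) T0 (- hi0)"
      using step[of 0] by auto
    obtain a where a: "\<And>T l. T > 0 \<Longrightarrow> avg_ge f T l \<Longrightarrow> l \<le> a"
      "\<And>T h. T > 0 \<Longrightarrow> avg_ge (\<lambda>x. - f x) T (- h) \<Longrightarrow> a \<le> h"
      using avg_bounds_common_point[OF cont \<open>T0 > 0\<close> lh0] by auto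
    \<comment> \<open>\<open>2 * C\<close> is the width of the initial bracket;
      \<open>\<mu> * T0\<close> pays for the starting scale and for rounding \<open>T\<close> down
      to a scale \<open>\<mu> ^ k * T0\<close>.\<close>
    define c where "c = 2 * C * (\<mu> * T0) powr \<delta>"
    have "C \<ge> 0"
      using C[of 0] by linarith
    have "avg_within f a T (c * T powr (- \<delta>))" if "T \<ge> T0" for T
    proof -
      define k where "k = nat \<lfloor>log \<mu> (T / T0)\<rfloor>"
      have "log \<mu> (T / T0) \<ge> 0"
        using that \<open>T0 > 0\<close> \<open>\<mu> > 1\<close> by (simp add: zero_le_log_cancel_iff)
      then have k: "real k \<le> log \<mu> (T / T0)" "log \<mu> (T / T0) < real k + 1"
        by (auto simp: k_def of_nat_nat)
      have "\<mu> powr real k \<le> T / T0" "T / T0 < \<mu> powr (real k + 1)"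
        using k \<open>\<mu> > 1\<close> that \<open>T0 > 0\<close> by (simp_all add: le_log_iff log_less_iff)
      then have k': "\<mu> ^ k * T0 \<le> T" "T < \<mu> ^ k * (\<mu> * T0)"
        using \<open>\<mu> > 1\<close> \<open>T0 > 0\<close> by (simp_all add: powr_add powr_realpow pos_le_divide_eq pos_divide_less_eq mult_ac)
      obtain lo hi where lh: "hi - lo = \<theta> ^ k * (2 * C)" "avg_ge f (\<mu> ^ k * T0) lo"
          "avg_ge (\<lambda>x. - f x) (\<mu> ^ k * T0) (- hi)"
        using step by blast
      have pos: "\<mu> ^ k * T0 > 0"
        using \<open>\<mu> > 1\<close> \<open>T0 > 0\<close> by simp
      have "lo \<le> a" "a \<le> hi"
        using a[OF pos] lh by auto
      have "T / (\<mu> * T0) \<le> \<mu> ^ k"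
        using k' \<open>\<mu> > 1\<close> \<open>T0 > 0\<close> by (simp add: field_simps)
      then have "(\<mu> ^ k) powr (- \<delta>) \<le> (T / (\<mu> * T0)) powr (- \<delta>)"
        using that \<open>\<mu> > 1\<close> \<open>T0 > 0\<close> \<open>\<delta> > 0\<close> by (intro powr_mono2') auto
      also have "\<dots> = (\<mu> * T0) powr \<delta> * T powr (- \<delta>)"
        using that \<open>\<mu> > 1\<close> \<open>T0 > 0\<close> by (simp add: powr_divide powr_minus_divide)
      finally have "2 * C * (\<mu> ^ k) powr (- \<delta>) \<le> 2 * C * ((\<mu> * T0) powr \<delta> * T powr (- \<delta>))"
        using \<open>C \<ge> 0\<close> by (intro mult_left_mono) auto
      then have "hi - lo \<le> c * T powr (- \<delta>)"
        unfolding lh(1) \<theta>_pow c_def by (simp add: mult_ac)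
      then have "a - c * T powr (- \<delta>) \<le> lo" "- (a + c * T powr (- \<delta>)) \<le> - hi"
        using \<open>lo \<le> a\<close> \<open>a \<le> hi\<close> by linarith+
      then show ?thesis
        unfolding avg_within_def using avg_ge_mono[OF lh(2) k'(1)] avg_ge_mono[OF lh(3) k'(1)] by auto
    qed
    then show ?thesis
      using \<open>T0 > 0\<close> by blast
  qed
  note main = this
  show ?thesis
  proof (rule exI[of _ \<delta>], intro conjI allI impI)
    fix f \<rho> C
    assume "continuous_on UNIV f" "pattern_equivariant X \<rho> f" "\<forall>x. \<bar>f x\<bar> \<le> C"
    then show "\<exists>a c T0. T0 > 0 \<and> (\<forall>T\<ge>T0. avg_within f a T (c * T powr (- \<delta>)))"
      by (intro main) auto
  qed (fact \<open>\<delta> > 0\<close>)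
qed

section \<open>Convergence of averages: dense repetitivity\<close>

definition smooth :: "real \<Rightarrow> (real ^ 'n \<Rightarrow> real) \<Rightarrow> real ^ 'n \<Rightarrow> real" where
  "smooth T f z = integral (cbox 0 (vec T)) (\<lambda>w. f (z + w)) / T ^ CARD('n)"

lemma continuous_on_smooth:
  fixes f :: "real ^ 'n \<Rightarrow> real"
  assumes cont: "continuous_on UNIV f"
  shows "continuous_on UNIV (smooth T f)"
proof -
  have "continuous_on (UNIV \<times> cbox 0 (vec T)) (\<lambda>(z, w). f (z + w))"
    unfolding split_beta by (intro continuous_on_compose2[OF cont] continuous_intros) auto
  then have "continuous_on UNIV (\<lambda>z. integral (cbox 0 (vec T)) (\<lambda>w. f (z + w)))"
    by (rule integral_continuous_on_param)
  then have "continuous_on UNIV (\<lambda>z. integral (cbox 0 (vec T)) (\<lambda>w. f (z + w)) / T ^ CARD('n))"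
    unfolding divide_inverse by (intro continuous_intros)
  then show ?thesis
    by (simp add: smooth_def[abs_def])
qed

lemma vol_vec_cube:
  fixes z :: "real ^ 'n"
  assumes "T \<ge> 0"
  shows "vol (cbox z (z + vec T)) = T ^ CARD('n)"
  using assms by (subst vol_cbox_cart) auto

text \<open>The window is the cube with lower corner \<open>z\<close>, itself a box with sides
  \<open>T\<close>. A bound on averages thus becomes a bound at every point, which can then be
  integrated over sets far smaller than a \<open>T\<close>-cube.\<close>

lemma smooth_ge:
  fixes f :: "real ^ 'n \<Rightarrow> real"
  assumes "T > 0" "avg_ge f T l"
  shows "l \<le> smooth T f z"
proof -
  have "l * T ^ CARD('n) \<le> integral (cbox z (z + vec T)) f"
    using avg_geD[OF assms(2), of "z + vec T" z] vol_vec_cube[of T z] assms(1) by simp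
  also have "\<dots> = integral (cbox 0 (vec T)) (\<lambda>w. f (z + w))"
    using integral_translate[of z 0 "vec T" f] by simp
  finally show ?thesis
    using assms(1) by (simp add: smooth_def field_simps)
qed

lemma smooth_uminus: "smooth T (\<lambda>x. - f x) z = - smooth T f z"
  by (simp add: smooth_def)

text \<open>Integrals of nonnegative functions grow with the domain; applied to \<open>f + C\<close>
  and \<open>C - f\<close> this yields the two sides of the estimate.\<close>

lemma integral_subbox_diff:
  fixes f :: "real ^ 'n \<Rightarrow> real"
  assumes cont: "continuous_on UNIV f" and C: "\<And>x. \<bar>f x\<bar> \<le> C" and sub: "cbox p q \<subseteq> cbox u v"
  shows "\<bar>integral (cbox u v) f - integral (cbox p q) f\<bar> \<le> C * (vol (cbox u v) - vol (cbox p q))"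
proof -
  note int = continuous_integrable_cbox
  have bounds: "0 \<le> f x + C" "0 \<le> C - f x" for x
    using C[of x] by auto
  have "integral (cbox p q) (\<lambda>x. f x + C) \<le> integral (cbox u v) (\<lambda>x. f x + C)"
    using sub bounds(1) by (intro integral_subset_le int continuous_intros cont ballI)
  moreover have "integral (cbox p q) (\<lambda>x. C - f x) \<le> integral (cbox u v) (\<lambda>x. C - f x)"
    using sub bounds(2) by (intro integral_subset_le int continuous_intros cont ballI)
  moreover have "integral (cbox a b) (\<lambda>x. f x + C) = integral (cbox a b) f + C * vol (cbox a b)"
    "integral (cbox a b) (\<lambda>x. C - f x) = C * vol (cbox a b) - integral (cbox a b) f" for a b
    using int[OF cont] by (subst integral_add integral_diff; auto)+
  ultimately show ?thesis
    by (simp add: algebra_simps abs_le_iff)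
qed

text \<open>A box and its shift by \<open>w\<close> share \<open>cbox (w + u) v\<close>. The
  relative volume of the overlap is the product of the factors
  \<open>1 - w $ i / (v $ i - u $ i)\<close>, at least 1 minus the sum of the quotients by
  Weierstrass's inequality. The factor 2 counts the two leftovers.\<close>

lemma integral_translate_diff:
  fixes f :: "real ^ 'n \<Rightarrow> real"
  assumes cont: "continuous_on UNIV f" and C: "\<And>x. \<bar>f x\<bar> \<le> C" and "S > 0"
    and side: "\<And>i. S \<le> v $ i - u $ i" and w: "\<And>i. 0 \<le> w $ i" "\<And>i. w $ i \<le> T" and "T \<le> S"
  shows "\<bar>integral (cbox (w + u) (w + v)) f - integral (cbox u v) f\<bar>
    \<le> 2 * C * (real CARD('n) * T / S) * vol (cbox u v)"
proof -
  have "C \<ge> 0"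
    using C[of 0] by linarith
  have uv: "u $ i \<le> v $ i" "(w + u) $ i \<le> v $ i" for i
    using side[of i] w(2)[of i] \<open>S > 0\<close> \<open>T \<le> S\<close> by auto
  have vol1: "vol (cbox u v) = (\<Prod>i\<in>UNIV. v $ i - u $ i)"
    using uv by (intro vol_cbox_cart)
  have vol2: "vol (cbox (w + u) (w + v)) = vol (cbox u v)"
    using uv by (simp add: vol_cbox_cart)
  have vol3: "vol (cbox (w + u) v) = (\<Prod>i\<in>UNIV. v $ i - u $ i - w $ i)"
    using uv(2) by (subst vol_cbox_cart) (auto simp: algebra_simps)
  have pos: "v $ i - u $ i > 0" for i
    using side[of i] \<open>S > 0\<close> by linarith
  have ratio: "w $ i / (v $ i - u $ i) \<in> {0..1}" "w $ i / (v $ i - u $ i) \<le> T / S" for i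
  proof -
    have "w $ i / (v $ i - u $ i) \<le> T / S"
      using w[of i] side[of i] \<open>S > 0\<close> by (intro frac_le) auto
    moreover have "T / S \<le> 1"
      using \<open>T \<le> S\<close> \<open>S > 0\<close> by simp
    moreover have "0 \<le> w $ i / (v $ i - u $ i)"
      using w(1)[of i] pos[of i] by simp
    ultimately show "w $ i / (v $ i - u $ i) \<in> {0..1}" "w $ i / (v $ i - u $ i) \<le> T / S"
      by auto
  qed
  have "1 - real CARD('n) * T / S \<le> 1 - (\<Sum>i\<in>UNIV. w $ i / (v $ i - u $ i))"
    using sum_mono[of UNIV "\<lambda>i. w $ i / (v $ i - u $ i)" "\<lambda>_. T / S"] ratio(2) by simp
  also have "\<dots> \<le> (\<Prod>i\<in>UNIV. 1 - w $ i / (v $ i - u $ i))"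
    using ratio(1) by (intro Weierstrass_prod_ineq) auto
  finally have "(1 - real CARD('n) * T / S) * vol (cbox u v)
      \<le> (\<Prod>i\<in>UNIV. 1 - w $ i / (v $ i - u $ i)) * vol (cbox u v)"
    by (intro mult_right_mono) auto
  also have "\<dots> = vol (cbox (w + u) v)"
    unfolding vol1 vol3 prod.distrib[symmetric]
  proof (rule prod.cong)
    fix i
    show "(1 - w $ i / (v $ i - u $ i)) * (v $ i - u $ i) = v $ i - u $ i - w $ i"
      using pos[of i] by (simp add: left_diff_distrib)
  qed simp
  finally have loss: "vol (cbox u v) - vol (cbox (w + u) v) \<le> real CARD('n) * T / S * vol (cbox u v)"
    by (simp add: algebra_simps)
  have sub: "cbox (w + u) v \<subseteq> cbox u v" "cbox (w + u) v \<subseteq> cbox (w + u) (w + v)"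
  proof -
    have "u $ i \<le> x $ i \<and> x $ i \<le> (w + v) $ i" if "x \<in> cbox (w + u) v" for x i
      using w(1)[of i] that by (auto simp: mem_box_cart add_increasing dest!: spec[of _ i])
    then show "cbox (w + u) v \<subseteq> cbox u v" "cbox (w + u) v \<subseteq> cbox (w + u) (w + v)"
      by (auto simp: mem_box_cart)
  qed
  have "\<bar>integral (cbox u v) f - integral (cbox (w + u) v) f\<bar>
      \<le> C * (vol (cbox u v) - vol (cbox (w + u) v))"
    using sub(1) by (intro integral_subbox_diff cont C)
  moreover have "\<bar>integral (cbox (w + u) (w + v)) f - integral (cbox (w + u) v) f\<bar>
      \<le> C * (vol (cbox u v) - vol (cbox (w + u) v))"
    unfolding vol2[symmetric]
    using sub(2) by (intro integral_subbox_diff cont C)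
  moreover have "C * (vol (cbox u v) - vol (cbox (w + u) v)) \<le> C * (real CARD('n) * T / S * vol (cbox u v))"
    using loss \<open>C \<ge> 0\<close> by (rule mult_left_mono)
  ultimately show ?thesis
    by (simp add: mult.assoc)
qed

text \<open>Exchanging the order of integration turns the integral of \<open>smooth T f\<close> into
  the mean, over \<open>w\<close> in the \<open>T\<close>-cube, of the integrals of \<open>f\<close>
  over the box shifted by \<open>w\<close>, each close to the unshifted one.\<close>

lemma integral_smooth_diff:
  fixes f :: "real ^ 'n \<Rightarrow> real"
  assumes cont: "continuous_on UNIV f" and C: "\<And>x. \<bar>f x\<bar> \<le> C" and "T > 0" "T \<le> S"
    and side: "\<And>i. S \<le> v $ i - u $ i"
  shows "\<bar>integral (cbox u v) (smooth T f) - integral (cbox u v) f\<bar>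
    \<le> 2 * C * (real CARD('n) * T / S) * vol (cbox u v)"
proof -
  define E where "E = 2 * C * (real CARD('n) * T / S) * vol (cbox u v)"
  have cont2: "continuous_on A (\<lambda>(z, w). f (z + w))" for A
    unfolding split_beta by (intro continuous_on_compose2[OF cont] continuous_intros) auto
  have volT: "vol (cbox 0 (vec T) :: (real ^ 'n) set) = T ^ CARD('n)"
    using vol_vec_cube[of T 0] \<open>T > 0\<close> by simp
  define G where "G w = integral (cbox u v) (\<lambda>z. f (z + w))" for w
  have G: "\<bar>G w - integral (cbox u v) f\<bar> \<le> E" if "w \<in> cbox 0 (vec T)" for w
  proof -
    have "G w = integral (cbox (w + u) (w + v)) f"
      unfolding G_def integral_translate by (simp add: add.commute)
    moreover have "\<bar>integral (cbox (w + u) (w + v)) f - integral (cbox u v) f\<bar> \<le> E"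
      unfolding E_def using that \<open>T > 0\<close> \<open>T \<le> S\<close>
      by (intro integral_translate_diff[OF cont C]) (auto simp: mem_box_cart side)
    ultimately show ?thesis
      by simp
  qed
  have "continuous_on (UNIV \<times> cbox u v) (\<lambda>(w, z). f (z + w))"
    unfolding split_beta by (intro continuous_on_compose2[OF cont] continuous_intros) auto
  then have contG: "continuous_on UNIV G"
    unfolding G_def by (rule integral_continuous_on_param)
  have "integral (cbox u v) (smooth T f) =
      integral (cbox u v) (\<lambda>z. integral (cbox 0 (vec T)) (\<lambda>w. f (z + w))) / T ^ CARD('n)"
    by (simp add: smooth_def[abs_def])
  also have "\<dots> = integral (cbox 0 (vec T)) G / T ^ CARD('n)"
    unfolding G_def by (subst integral_swap_continuous[OF cont2]) simp
  finally have eq: "integral (cbox u v) (smooth T f) * T ^ CARD('n) = integral (cbox 0 (vec T)) G"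
    using \<open>T > 0\<close> by simp
  have "integral (cbox 0 (vec T)) G \<le> integral (cbox 0 (vec T :: real ^ 'n)) (\<lambda>_. integral (cbox u v) f + E)"
    using G by (intro integral_le continuous_integrable_cbox contG) (fastforce simp: abs_le_iff)+
  moreover have "integral (cbox 0 (vec T :: real ^ 'n)) (\<lambda>_. integral (cbox u v) f - E) \<le> integral (cbox 0 (vec T)) G"
    using G by (intro integral_le continuous_integrable_cbox contG) (fastforce simp: abs_le_iff)+
  ultimately have "integral (cbox u v) (smooth T f) * T ^ CARD('n) \<le> (integral (cbox u v) f + E) * T ^ CARD('n)"
    "(integral (cbox u v) f - E) * T ^ CARD('n) \<le> integral (cbox u v) (smooth T f) * T ^ CARD('n)"
    unfolding eq using volT by (simp_all add: mult.commute)
  then show ?thesis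
    unfolding E_def[symmetric] using \<open>T > 0\<close> by (simp add: abs_le_iff)
qed

text \<open>\<open>Y\<close> stands for the occurrences of one patch. Cubes of half-side
  \<open>M\<close> around them cover the box shrunk by \<open>M + a\<close> at each face, where
  \<open>a\<close> keeps the small cubes inside. The side condition preserves at least half of each
  side; together with the cube volume \<open>(2 * M) ^ CARD('n)\<close> this gives the
  constant.\<close>

lemma card_patch_in_box:
  fixes Y :: "(real ^ 'n) set"
  assumes "M > 0" "a > 0" and fin: "finite (Y \<inter> cbox u v)"
    and dense: "\<And>c. \<exists>x\<in>Y. norm (x - c) \<le> M"
    and side: "\<And>i. 4 * (M + a) \<le> v $ i - u $ i"
  shows "vol (cbox u v) \<le> (4 * M) ^ CARD('n) * real (card {x \<in> Y. cbox (x - vec a) (x + vec a) \<subseteq> cbox u v})"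
proof -
  define Z where "Z = {x \<in> Y. cbox (x - vec a) (x + vec a) \<subseteq> cbox u v}"
  define u' where "u' = u + vec (M + a)"
  define v' where "v' = v - vec (M + a)"
  have Z_sub: "Z \<subseteq> Y \<inter> cbox u v"
    using \<open>a > 0\<close> by (auto simp: Z_def subset_iff mem_box_cart)
  then have finZ: "finite Z"
    using fin finite_subset by blast
  have cover: "cbox u' v' \<subseteq> (\<Union>x\<in>Z. cbox (x - vec M) (x + vec M))"
  proof
    fix c assume c: "c \<in> cbox u' v'"
    obtain x where x: "x \<in> Y" "norm (x - c) \<le> M"
      using dense by blast
    have xi: "\<bar>x $ i - c $ i\<bar> \<le> M" for i
      using component_le_norm_cart[of "x - c" i] x(2) by simp
    have ci: "u $ i + (M + a) \<le> c $ i" "c $ i + (M + a) \<le> v $ i" for i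
      using c by (auto simp: mem_box_cart u'_def v'_def le_diff_eq)
    have "u $ i \<le> y $ i \<and> y $ i \<le> v $ i" if "y \<in> cbox (x - vec a) (x + vec a)" for y i
    proof -
      have "x $ i - a \<le> y $ i" "y $ i \<le> x $ i + a"
        using that by (auto simp: mem_box_cart)
      then show ?thesis
        using xi[of i] ci[of i] by (auto simp: abs_le_iff)
    qed
    then have "x \<in> Z"
      using x(1) by (auto simp: Z_def mem_box_cart)
    moreover have "c $ i \<le> x $ i + M" "x $ i - M \<le> c $ i" for i
      using xi[of i] by (auto simp: abs_le_iff)
    then have "c \<in> cbox (x - vec M) (x + vec M)"
      by (auto simp: mem_box_cart)
    ultimately show "c \<in> (\<Union>x\<in>Z. cbox (x - vec M) (x + vec M))"
      by blast
  qed
  have pos: "u $ i \<le> v $ i" "u' $ i \<le> v' $ i" "v $ i - u $ i \<le> 2 * (v' $ i - u' $ i)" for i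
    using side[of i] \<open>M > 0\<close> \<open>a > 0\<close> by (auto simp: u'_def v'_def)
  have "vol (cbox u v) \<le> (\<Prod>i\<in>UNIV. 2 * (v' $ i - u' $ i))"
    unfolding vol_cbox_cart[OF pos(1)] using pos by (intro prod_mono) auto
  also have "\<dots> = 2 ^ CARD('n) * vol (cbox u' v')"
    unfolding prod.distrib vol_cbox_cart[OF pos(2)] by simp
  also have "vol (cbox u' v') \<le> vol (\<Union>x\<in>Z. cbox (x - vec M) (x + vec M))"
    using cover finZ by (intro measure_mono_fmeasurable) (auto intro!: fmeasurable.finite_UN)
  also have "\<dots> \<le> (\<Sum>x\<in>Z. vol (cbox (x - vec M) (x + vec M)))"
    using finZ by (intro measure_UNION_le) auto
  also have "\<dots> = (\<Sum>x\<in>Z. (2 * M) ^ CARD('n))"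
    using \<open>M > 0\<close> by (intro sum.cong) (simp_all add: vol_cbox_cart)
  finally have "vol (cbox u v) \<le> 2 ^ CARD('n) * (real (card Z) * (2 * M) ^ CARD('n))"
    by simp
  also have "\<dots> = (4 * M) ^ CARD('n) * real (card Z)"
  proof -
    have "(4 * M) ^ CARD('n) = 2 ^ CARD('n) * (2 * M) ^ CARD('n)"
      unfolding power_mult_distrib[symmetric] by simp
    then show ?thesis
      by (simp only: mult_ac)
  qed
  finally show ?thesis
    by (simp add: Z_def)
qed

text \<open>
  Each patch occurs at least about \<open>vol / M ^ n\<close> times in a large box; small cubes around
  distinct points of \<open>X\<close> are disjoint.
\<close>

lemma patch_sum_le_integral:
  fixes X :: "(real ^ 'n) set"
  assumes lf: "\<And>B. bounded B \<Longrightarrow> finite (X \<inter> B)"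
    and sep: "\<And>x y. x \<in> X \<Longrightarrow> y \<in> X \<Longrightarrow> x \<noteq> y \<Longrightarrow> 2 * real CARD('n) * a < norm (x - y)"
    and "a > 0" "M > 0" and finP: "finite (patch X S ` X)"
    and rep: "\<And>c y. y \<in> X \<Longrightarrow> \<exists>x\<in>X. norm (x - c) \<le> M \<and> patch X S x = patch X S y"
    and cont: "continuous_on UNIV h" and nonneg: "\<And>x. 0 \<le> h x"
    and I: "\<And>x. x \<in> X \<Longrightarrow> integral (cbox (x - vec a) (x + vec a)) h = I (patch X S x)"
    and side: "\<And>i. 4 * (M + a) \<le> v $ i - u $ i"
  shows "(\<Sum>p\<in>patch X S ` X. I p) / (4 * M) ^ CARD('n) * vol (cbox u v) \<le> integral (cbox u v) h"
proof -
  let ?c = "\<lambda>x. cbox (x - vec a) (x + vec a)"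
  define Z where "Z = {x \<in> X. ?c x \<subseteq> cbox u v}"
  define P where "P = patch X S ` X"
  have "Z \<subseteq> X \<inter> cbox u v"
    using \<open>a > 0\<close> by (auto simp: Z_def subset_iff mem_box_cart)
  then have finZ: "finite Z"
    using lf[OF bounded_cbox] finite_subset by blast
  have count: "vol (cbox u v) \<le> (4 * M) ^ CARD('n) * real (card {x \<in> Z. patch X S x = p})" if "p \<in> P" for p
  proof -
    obtain y where y: "y \<in> X" "p = patch X S y"
      using \<open>p \<in> P\<close> by (auto simp: P_def)
    have "vol (cbox u v) \<le> (4 * M) ^ CARD('n) *
        real (card {x \<in> {x \<in> X. patch X S x = p}. ?c x \<subseteq> cbox u v})"
    proof (rule card_patch_in_box[OF \<open>M > 0\<close> \<open>a > 0\<close> _ _ side])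
      show "finite ({x \<in> X. patch X S x = p} \<inter> cbox u v)"
        using lf[OF bounded_cbox[of u v]] by (rule rev_finite_subset) auto
      show "\<exists>x\<in>{x \<in> X. patch X S x = p}. norm (x - c) \<le> M" for c
        using rep[OF y(1), of c] y(2) by auto
    qed
    also have "{x \<in> {x \<in> X. patch X S x = p}. ?c x \<subseteq> cbox u v} = {x \<in> Z. patch X S x = p}"
      by (auto simp: Z_def)
    finally show ?thesis .
  qed
  have I_nonneg: "I p \<ge> 0" if p: "p \<in> P" for p
  proof -
    obtain y where y: "y \<in> X" "p = patch X S y"
      using p by (auto simp: P_def)
    have "0 \<le> integral (?c y) h"
      using nonneg continuous_integrable_cbox[OF cont] by (intro integral_nonneg)
    then show ?thesis
      using I[OF y(1)] y(2) by simp
  qed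
  have "(\<Sum>p\<in>P. I p) / (4 * M) ^ CARD('n) * vol (cbox u v)
      = (\<Sum>p\<in>P. I p * (vol (cbox u v) / (4 * M) ^ CARD('n)))"
    by (simp add: sum_distrib_right sum_divide_distrib)
  also have "\<dots> \<le> (\<Sum>p\<in>P. I p * real (card {x \<in> Z. patch X S x = p}))"
    using count I_nonneg \<open>M > 0\<close>
    by (intro sum_mono mult_left_mono) (simp_all add: pos_divide_le_eq mult.commute)
  also have "\<dots> = (\<Sum>p\<in>P. \<Sum>x\<in>{x \<in> Z. patch X S x = p}. I (patch X S x))"
    by (intro sum.cong) (simp_all add: mult.commute)
  also have "\<dots> = (\<Sum>x\<in>Z. I (patch X S x))"
    using finZ finP by (intro sum.group) (auto simp: P_def Z_def)
  also have "\<dots> = (\<Sum>x\<in>Z. integral (?c x) h)"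
    using I by (intro sum.cong) (auto simp: Z_def)
  also have "\<dots> = integral (\<Union>x\<in>Z. ?c x) h"
  proof (rule integral_unique[symmetric], rule has_integral_UN[OF finZ])
    show "(h has_integral integral (?c x) h) (?c x)" for x
      using continuous_integrable_cbox[OF cont] by (simp add: has_integral_integral)
    have "?c x \<inter> ?c y = {}" if xy: "x \<in> Z" "y \<in> Z" "x \<noteq> y" for x y
    proof (rule ccontr)
      assume "?c x \<inter> ?c y \<noteq> {}"
      then obtain z where z: "z \<in> ?c x" "z \<in> ?c y"
        by blast
      have "\<bar>(x - y) $ i\<bar> \<le> 2 * a" for i
      proof -
        have "x $ i - a \<le> z $ i" "z $ i \<le> x $ i + a" "y $ i - a \<le> z $ i" "z $ i \<le> y $ i + a"
          using z by (auto simp: mem_box_cart)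
        then show ?thesis
          by (simp add: abs_le_iff)
      qed
      then have "norm (x - y) \<le> real CARD('n) * (2 * a)"
        by (rule norm_le_card_mult)
      then show False
        using sep[of x y] xy by (simp add: Z_def)
    qed
    then show "pairwise (\<lambda>x y. negligible (?c x \<inter> ?c y)) Z"
      by (simp add: pairwise_def)
  qed
  \<comment> \<open>Since \<open>h\<close> is nonnegative, the part of the box outside the cubes may
    be dropped.\<close>
  also have "\<dots> \<le> integral (cbox u v) h"
  proof (rule integral_subset_le)
    show "h integrable_on (\<Union>x\<in>Z. ?c x)"
    proof -
      have "h absolutely_integrable_on (cbox u v)"
        using continuous_integrable_cbox[OF cont] nonneg by (intro nonnegative_absolutely_integrable_1) auto
      then have "h absolutely_integrable_on (\<Union>x\<in>Z. ?c x)"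
        by (rule set_integrable_subset) (use finZ in \<open>auto simp: Z_def intro!: sets.finite_UN\<close>)
      then show ?thesis
        by (rule absolutely_integrable_on_def[THEN iffD1, THEN conjunct1])
    qed
  qed (use nonneg continuous_integrable_cbox[OF cont] in \<open>auto simp: Z_def\<close>)
  finally show ?thesis
    by (simp add: P_def)
qed

text \<open>Over the \<open>a\<close>-cube, \<open>smooth T f\<close> reads \<open>f\<close> at
  offsets with coordinates up to \<open>a + T\<close>, hence of norm up to
  \<open>CARD('n) * (a + T)\<close>; adding the range \<open>\<rho>\<close> gives a sufficient patch
  radius.\<close>

lemma smooth_integral_patch_invariant:
  fixes X :: "(real ^ 'n) set"
  assumes pe: "pattern_equivariant X \<rho> f" and S: "real CARD('n) * (a + T) + \<rho> \<le> S"
    and x: "x \<in> X" "x' \<in> X" "patch X S x = patch X S x'"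
  shows "integral (cbox (x - vec a) (x + vec a)) (smooth T f)
    = integral (cbox (x' - vec a) (x' + vec a)) (smooth T f)"
proof -
  have eq: "smooth T f (x + w) = smooth T f (x' + w)" if w: "w \<in> cbox (- vec a) (vec a)" for w
  proof -
    have "f (x + w + t) = f (x' + w + t)" if t: "t \<in> cbox 0 (vec T)" for t
    proof -
      have "\<bar>(w + t) $ i\<bar> \<le> a + T" for i
      proof -
        have "- a \<le> w $ i" "w $ i \<le> a" "0 \<le> t $ i" "t $ i \<le> T"
          using w t by (auto simp: mem_box_cart)
        then show ?thesis
          by (auto simp: abs_le_iff)
      qed
      then have "norm (w + t) \<le> real CARD('n) * (a + T)"
        by (rule norm_le_card_mult)
      then have "norm (w + t) + \<rho> \<le> S"
        using S by linarith
      then have "f (x + (w + t)) = f (x' + (w + t))"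
        using pe x unfolding pattern_equivariant_def by blast
      then show ?thesis
        by (simp only: add.assoc)
    qed
    then have "integral (cbox 0 (vec T)) (\<lambda>t. f (x + w + t)) = integral (cbox 0 (vec T)) (\<lambda>t. f (x' + w + t))"
      by (rule integral_cong)
    then show ?thesis
      by (simp add: smooth_def)
  qed
  have shift: "integral (cbox (y - vec a) (y + vec a)) (smooth T f)
      = integral (cbox (- vec a) (vec a)) (\<lambda>w. smooth T f (y + w))" for y
    using integral_translate[of y "- vec a" "vec a" "smooth T f"] by simp
  show ?thesis
    unfolding shift using eq by (rule integral_cong)
qed

text \<open>After smoothing, \<open>h = smooth T f - l\<close> is nonnegative everywhere, so each
  occurrence of a patch contributes its excess over \<open>l\<close> on an \<open>a\<close>-cube and
  the rest can be discarded. The subtracted term is the price for returning from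
  \<open>smooth T f\<close> to \<open>f\<close>.\<close>

lemma dense_improvement:
  fixes X :: "(real ^ 'n) set"
  assumes lf: "\<And>B. bounded B \<Longrightarrow> finite (X \<inter> B)"
    and sep: "\<And>x y. x \<in> X \<Longrightarrow> y \<in> X \<Longrightarrow> x \<noteq> y \<Longrightarrow> 2 * real CARD('n) * a < norm (x - y)"
    and "a > 0" "M > 0" and finP: "finite (patch X S ` X)"
    and rep: "\<And>c y. y \<in> X \<Longrightarrow> \<exists>x\<in>X. norm (x - c) \<le> M \<and> patch X S x = patch X S y"
    and cont: "continuous_on UNIV f" and C: "\<And>x. \<bar>f x\<bar> \<le> C"
    and I: "\<And>x. x \<in> X \<Longrightarrow> integral (cbox (x - vec a) (x + vec a)) (smooth T f) = I (patch X S x)"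
    and T: "T > 0" and U: "T \<le> U" "4 * (M + a) \<le> U" and avg: "avg_ge f T l"
  shows "avg_ge f U (l + (\<Sum>p\<in>patch X S ` X. I p - l * (2 * a) ^ CARD('n)) / (4 * M) ^ CARD('n)
    - 2 * C * (real CARD('n) * T / U))"
  unfolding avg_ge_def
proof safe
  fix u v :: "real ^ 'n"
  assume side: "\<forall>i. U \<le> v $ i - u $ i"
  define h where "h z = smooth T f z - l" for z
  have cs: "continuous_on UNIV (smooth T f)"
    using cont by (rule continuous_on_smooth)
  then have ch: "continuous_on UNIV h"
    unfolding h_def by (intro continuous_intros)
  have ih: "integral (cbox p q) h = integral (cbox p q) (smooth T f) - l * vol (cbox p q)" for p q
    unfolding h_def using continuous_integrable_cbox[OF cs] by (subst integral_diff) auto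
  have "(\<Sum>p\<in>patch X S ` X. I p - l * (2 * a) ^ CARD('n)) / (4 * M) ^ CARD('n) * vol (cbox u v)
      \<le> integral (cbox u v) h"
  proof (rule patch_sum_le_integral[OF lf sep \<open>a > 0\<close> \<open>M > 0\<close> finP rep ch])
    show "0 \<le> h x" for x
      using smooth_ge[OF T avg] by (simp add: h_def)
    show "4 * (M + a) \<le> v $ i - u $ i" for i
      using side U by (meson order_trans)
    show "integral (cbox (x - vec a) (x + vec a)) h = I (patch X S x) - l * (2 * a) ^ CARD('n)"
      if "x \<in> X" for x
      using I[OF that] \<open>a > 0\<close> by (simp add: ih vol_cbox_cart)
  qed
  moreover have "\<bar>integral (cbox u v) (smooth T f) - integral (cbox u v) f\<bar>
    \<le> 2 * C * (real CARD('n) * T / U) * vol (cbox u v)"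
    using side by (intro integral_smooth_diff[OF cont C T U(1)]) auto
  ultimately show "(l + (\<Sum>p\<in>patch X S ` X. I p - l * (2 * a) ^ CARD('n)) / (4 * M) ^ CARD('n)
    - 2 * C * (real CARD('n) * T / U)) * vol (cbox u v) \<le> integral (cbox u v) f"
    unfolding ih left_diff_distrib distrib_right by linarith
qed

text \<open>The local integrals \<open>I p\<close> are unknown, but passing to \<open>- f\<close>
  only changes their sign. In the sum \<open>J1 + J2\<close> of the gains at both ends they cancel,
  leaving \<open>hi - lo\<close> times the share of volume carried by the small cubes; dense
  repetitivity bounds that share from below, however the gain is distributed.\<close>

lemma dense_contraction:
  fixes X :: "(real ^ 'n) set"
  assumes lf: "\<And>B. bounded B \<Longrightarrow> finite (X \<inter> B)"
    and sep: "\<And>x y. x \<in> X \<Longrightarrow> y \<in> X \<Longrightarrow> x \<noteq> y \<Longrightarrow> 2 * real CARD('n) * a < norm (x - y)"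
    and "a > 0" "K > 0"
    and rep: "\<And>S. S \<ge> T1 \<Longrightarrow> \<exists>M>0. finite (patch X S ` X) \<and>
      M ^ CARD('n) \<le> K * real (card (patch X S ` X)) \<and>
      (\<forall>c. \<forall>y\<in>X. \<exists>x\<in>X. norm (x - c) \<le> M \<and> patch X S x = patch X S y)"
    and cont: "continuous_on UNIV f" and C: "\<And>x. \<bar>f x\<bar> \<le> C" and pe: "pattern_equivariant X \<rho> f"
    and T: "T > 0" and "\<eta> > 0" "lo \<le> hi"
    and lo: "avg_ge f T lo" and hi: "avg_ge (\<lambda>x. - f x) T (- hi)"
  shows "\<exists>U>0. \<exists>lo' hi'. avg_ge f U lo' \<and> avg_ge (\<lambda>x. - f x) U (- hi') \<and>
    hi' - lo' \<le> (1 - (a / 2) ^ CARD('n) / K) * (hi - lo) + \<eta>"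
proof -
  define S where "S = max T1 (real CARD('n) * (a + T) + \<rho>)"
  obtain M where "M > 0" and finP: "finite (patch X S ` X)"
    and card: "M ^ CARD('n) \<le> K * real (card (patch X S ` X))"
    and M: "\<And>c y. y \<in> X \<Longrightarrow> \<exists>x\<in>X. norm (x - c) \<le> M \<and> patch X S x = patch X S y"
    using rep[of S] by (auto simp: S_def)
  define P where "P = patch X S ` X"
  have "C \<ge> 0"
    using C[of 0] by linarith
  \<comment> \<open>The scale must admit the counting of patches and make the two smoothing errors
    together at most \<open>\<eta>\<close>.\<close>
  define U where "U = max (max (4 * (M + a)) T) (4 * C * real CARD('n) * T / \<eta>)"
  have U: "T \<le> U" "4 * (M + a) \<le> U" "4 * C * real CARD('n) * T / \<eta> \<le> U"
    by (auto simp: U_def)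
  have "U > 0"
    using T U by linarith
  define E where "E = 2 * C * (real CARD('n) * T / U)"
  have "2 * E \<le> \<eta>"
    using U(3) \<open>\<eta> > 0\<close> \<open>U > 0\<close> by (simp add: E_def field_simps)
  \<comment> \<open>Choosing one point for each patch makes the local integral a function of the
    patch; by invariance the choice is immaterial.\<close>
  define rp where "rp p = (SOME y. y \<in> X \<and> patch X S y = p)" for p
  have rp: "rp (patch X S x) \<in> X" "patch X S (rp (patch X S x)) = patch X S x" if "x \<in> X" for x
    using someI_ex[of "\<lambda>y. y \<in> X \<and> patch X S y = patch X S x"] that by (auto simp: rp_def)
  define I where "I p = integral (cbox (rp p - vec a) (rp p + vec a)) (smooth T f)" for p
  have I: "integral (cbox (x - vec a) (x + vec a)) (smooth T f) = I (patch X S x)" if "x \<in> X" for x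
    unfolding I_def using that rp[OF that]
    by (intro smooth_integral_patch_invariant[OF pe, where S = S]) (auto simp: S_def)
  have I': "integral (cbox (x - vec a) (x + vec a)) (smooth T (\<lambda>x. - f x)) = - I (patch X S x)" if "x \<in> X" for x
    using I[OF that] by (simp add: smooth_uminus[abs_def])
  have cont': "continuous_on UNIV (\<lambda>x. - f x)"
    by (intro continuous_intros cont)
  define J1 where "J1 = (\<Sum>p\<in>P. I p - lo * (2 * a) ^ CARD('n)) / (4 * M) ^ CARD('n)"
  define J2 where "J2 = (\<Sum>p\<in>P. - I p - (- hi) * (2 * a) ^ CARD('n)) / (4 * M) ^ CARD('n)"
  have 1: "avg_ge f U (lo + J1 - E)"
    unfolding J1_def E_def P_def
    by (rule dense_improvement[OF lf sep \<open>a > 0\<close> \<open>M > 0\<close> finP M cont C I T U(1,2) lo])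
  have C': "\<bar>- f x\<bar> \<le> C" for x
    using C by simp
  have 2: "avg_ge (\<lambda>x. - f x) U (- hi + J2 - E)"
    unfolding J2_def E_def P_def
    by (rule dense_improvement[OF lf sep \<open>a > 0\<close> \<open>M > 0\<close> finP M cont' C' I' T U(1,2) hi])
  have "J1 + J2 = (\<Sum>p\<in>P. (hi - lo) * (2 * a) ^ CARD('n)) / (4 * M) ^ CARD('n)"
    unfolding J1_def J2_def add_divide_distrib[symmetric] sum.distrib[symmetric]
    by (simp add: algebra_simps)
  also have "\<dots> = (hi - lo) * (real (card P) * (2 * a) ^ CARD('n) / (4 * M) ^ CARD('n))"
    by simp
  also have "\<dots> \<ge> (hi - lo) * ((a / 2) ^ CARD('n) / K)"
  proof (rule mult_left_mono)
    have "(4 * M) ^ CARD('n) * (a / 2) ^ CARD('n) = (2 * a) ^ CARD('n) * M ^ CARD('n)"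
      unfolding power_mult_distrib[symmetric] by (simp add: mult_ac)
    also have "\<dots> \<le> (2 * a) ^ CARD('n) * (K * real (card P))"
      using card \<open>a > 0\<close> by (intro mult_left_mono) (auto simp: P_def)
    finally have "(4 * M) ^ CARD('n) * (a / 2) ^ CARD('n) \<le> (2 * a) ^ CARD('n) * (K * real (card P))" .
    moreover have "(4 * M) ^ CARD('n) > 0"
      using \<open>M > 0\<close> by simp
    moreover have "p / K \<le> c * q / m" if "m * p \<le> q * (K * c)" "m > 0" for p q m c :: real
      using that \<open>K > 0\<close> by (simp add: field_simps)
    ultimately show "(a / 2) ^ CARD('n) / K \<le> real (card P) * (2 * a) ^ CARD('n) / (4 * M) ^ CARD('n)"
      by blast
  qed (use \<open>lo \<le> hi\<close> in simp)
  finally have "(hi - lo) * ((a / 2) ^ CARD('n) / K) \<le> J1 + J2" .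
  moreover have "(1 - (a / 2) ^ CARD('n) / K) * (hi - lo) = (hi - lo) - (hi - lo) * ((a / 2) ^ CARD('n) / K)"
    by (metis left_diff_distrib mult_1 mult.commute)
  ultimately have "(hi - J2 + E) - (lo + J1 - E) \<le> (1 - (a / 2) ^ CARD('n) / K) * (hi - lo) + \<eta>"
    using \<open>2 * E \<le> \<eta>\<close> by linarith
  moreover have "- hi + J2 - E = - (hi - J2 + E)"
    by simp
  ultimately show ?thesis
    using 1 2 \<open>U > 0\<close> by metis
qed

text \<open>A positive infimum \<open>\<omega>\<close> of the bracket widths is impossible, because
  contracting a nearly optimal bracket with a small error \<open>\<eta>\<close> falls below
  it.\<close>

lemma densely_repetitive_averages:
  fixes X :: "(real ^ 'n) set"
  assumes "delone X" "finite_type X" "0 \<in> X" "densely_repetitive X"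
    and cont: "continuous_on UNIV f" and pe: "pattern_equivariant X \<rho> f" and C: "\<And>x. \<bar>f x\<bar> \<le> C"
  shows "\<exists>b. \<forall>e>0. \<exists>T>0. avg_within f b T e"
proof -
  obtain K T1 where "K > 0" "T1 > 0" and
    rep: "\<And>S. S \<ge> T1 \<Longrightarrow> \<exists>M>0. finite (patch X S ` X) \<and>
      M ^ CARD('n) \<le> K * real (card (patch X S ` X)) \<and>
      (\<forall>c. \<forall>y\<in>X. \<exists>x\<in>X. norm (x - c) \<le> M \<and> patch X S x = patch X S y)"
    using densely_repetitive_radius[OF assms(1-4)] by blast
  obtain r where r: "r > 0" "\<And>x y. x \<in> X \<Longrightarrow> y \<in> X \<Longrightarrow> x \<noteq> y \<Longrightarrow> r \<le> norm (x - y)"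
    using delone_separated[OF assms(1)] by blast
  \<comment> \<open>Then \<open>2 * real CARD('n) * a\<close> is \<open>r / 2\<close>, so cubes of
    half-side \<open>a\<close> around distinct points of \<open>X\<close> are disjoint.\<close>
  define a where "a = r / (4 * real CARD('n))"
  have "a > 0"
    using r(1) by (simp add: a_def)
  have "2 * real CARD('n) * a < r"
    using r(1) by (simp add: a_def)
  then have sep: "2 * real CARD('n) * a < norm (x - y)" if "x \<in> X" "y \<in> X" "x \<noteq> y" for x y
    using r(2)[OF that] by linarith
  \<comment> \<open>The minimum keeps \<open>1 - \<kappa>\<close> nonnegative, so that an upper
    bound on the old width can be multiplied by it.\<close>
  define \<kappa> where "\<kappa> = min 1 ((a / 2) ^ CARD('n) / K)"
  have \<kappa>: "0 < \<kappa>" "\<kappa> \<le> 1"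
    using \<open>a > 0\<close> \<open>K > 0\<close> by (auto simp: \<kappa>_def)
  define bracket where "bracket T lo hi \<longleftrightarrow> avg_ge f T lo \<and> avg_ge (\<lambda>x. - f x) T (- hi)" for T lo hi
  have cont': "continuous_on UNIV (\<lambda>x. - f x)"
    by (intro continuous_intros cont)
  have "- C \<le> f x" "- C \<le> - f x" for x
    using C[of x] by auto
  then have init: "bracket 1 (- C) C"
    unfolding bracket_def using cont cont' by (intro conjI avg_ge_of_lower_bound) auto
  have init': "avg_ge f 1 (- C)" "avg_ge (\<lambda>x. - f x) 1 (- C)"
    using init by (auto simp: bracket_def)
  obtain b where b: "\<And>T l. T > 0 \<Longrightarrow> avg_ge f T l \<Longrightarrow> l \<le> b"
    "\<And>T h. T > 0 \<Longrightarrow> avg_ge (\<lambda>x. - f x) T (- h) \<Longrightarrow> b \<le> h"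
    using avg_bounds_common_point[OF cont zero_less_one init'] by auto
  have step: "\<exists>U>0. \<exists>lo' hi'. bracket U lo' hi' \<and> hi' - lo' \<le> (1 - \<kappa>) * (hi - lo) + \<eta>"
    if "T > 0" "bracket T lo hi" "\<eta> > 0" for T lo hi \<eta>
  proof -
    have lh: "avg_ge f T lo" "avg_ge (\<lambda>x. - f x) T (- hi)" "lo \<le> hi"
      using that b[OF \<open>T > 0\<close>] by (auto simp: bracket_def intro: order_trans)
    obtain U lo' hi' where "U > 0" "avg_ge f U lo'" "avg_ge (\<lambda>x. - f x) U (- hi')"
      and gap: "hi' - lo' \<le> (1 - (a / 2) ^ CARD('n) / K) * (hi - lo) + \<eta>"
      using dense_contraction[OF finite_type_locally_finite[OF assms(2,3)] sep \<open>a > 0\<close> \<open>K > 0\<close> rep cont C pe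
          \<open>T > 0\<close> \<open>\<eta> > 0\<close> lh(3,1,2)] by blast
    have "(1 - (a / 2) ^ CARD('n) / K) * (hi - lo) \<le> (1 - \<kappa>) * (hi - lo)"
      using lh(3) by (intro mult_right_mono) (auto simp: \<kappa>_def)
    then have "hi' - lo' \<le> (1 - \<kappa>) * (hi - lo) + \<eta>"
      using gap by linarith
    then show ?thesis
      using \<open>U > 0\<close> \<open>avg_ge f U lo'\<close> \<open>avg_ge (\<lambda>x. - f x) U (- hi')\<close> by (auto simp: bracket_def)
  qed
  define G where "G = {hi - lo | lo hi. \<exists>T>0. bracket T lo hi}"
  define \<omega> where "\<omega> = Inf G"
  have G_pos: "0 \<le> g" if "g \<in> G" for g
    using that b by (fastforce simp: G_def bracket_def)
  have G_ne: "G \<noteq> {}"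
    using init zero_less_one unfolding G_def by blast
  have bdd: "bdd_below G"
    using G_pos by (auto simp: bdd_below_def)
  have "\<omega> \<ge> 0"
    unfolding \<omega>_def using G_ne G_pos by (intro cInf_greatest)
  have "\<omega> = 0"
  proof (rule ccontr)
    assume "\<omega> \<noteq> 0"
    then have "\<omega> > 0"
      using \<open>\<omega> \<ge> 0\<close> by simp
    \<comment> \<open>Slack \<open>\<kappa> * \<omega> / 4\<close> is allowed twice, in the starting
      width and as \<open>\<eta>\<close>; the contraction saves at least
      \<open>\<kappa> * \<omega>\<close>, so the new width stays below
      \<open>\<omega>\<close>.\<close>
    then have pos: "\<kappa> * \<omega> / 4 > 0"
      using \<kappa> by simp
    then obtain g where g: "g \<in> G" "g < \<omega> + \<kappa> * \<omega> / 4"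
      using cInf_lessD[OF G_ne, of "\<omega> + \<kappa> * \<omega> / 4"] by (auto simp: \<omega>_def)
    then obtain T lo hi where "T > 0" "bracket T lo hi" "g = hi - lo"
      by (auto simp: G_def)
    then obtain U lo' hi' where U: "U > 0" "bracket U lo' hi'"
      and gap: "hi' - lo' \<le> (1 - \<kappa>) * g + \<kappa> * \<omega> / 4"
      using step pos by blast
    have "hi' - lo' \<in> G"
      using U by (auto simp: G_def)
    then have "\<omega> \<le> hi' - lo'"
      unfolding \<omega>_def using bdd by (rule cInf_lower)
    also have "\<dots> \<le> (1 - \<kappa>) * (\<omega> + \<kappa> * \<omega> / 4) + \<kappa> * \<omega> / 4"
      using gap mult_left_mono[of g "\<omega> + \<kappa> * \<omega> / 4" "1 - \<kappa>"] g(2) \<kappa>(2) by linarith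
    also have "\<dots> = \<omega> - \<kappa> * \<omega> / 2 - \<kappa> * (\<kappa> * \<omega> / 4)"
      by (simp add: field_simps)
    also have "\<dots> < \<omega>"
      using pos mult_pos_pos[OF \<kappa>(1) pos] by linarith
    finally show False
      by simp
  qed
  have "\<exists>T>0. avg_within f b T e" if e: "e > 0" for e
  proof -
    obtain g where "g \<in> G" "g < e"
      using cInf_lessD[OF G_ne, of e] e \<open>\<omega> = 0\<close> by (auto simp: \<omega>_def)
    then obtain T lo hi where T: "T > 0" "avg_ge f T lo" "avg_ge (\<lambda>x. - f x) T (- hi)" "hi - lo < e"
      by (auto simp: G_def bracket_def)
    then have "b - e \<le> lo" "- (b + e) \<le> - hi"
      using b[OF T(1)] by force+
    then have "avg_within f b T e"
      unfolding avg_within_def using avg_ge_mono[OF T(2) order_refl] avg_ge_mono[OF T(3) order_refl] by blast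
    then show ?thesis
      using T(1) by blast
  qed
  then show ?thesis
    by blast
qed

section \<open>From averages of increments to a linear approximation\<close>

lemma smooth_ge_pointwise:
  fixes f :: "real ^ 'n \<Rightarrow> real"
  assumes cont: "continuous_on UNIV f" and "T > 0" and l: "\<And>w. w \<in> cbox 0 (vec T) \<Longrightarrow> l \<le> f (z + w)"
  shows "l \<le> smooth T f z"
proof -
  have "continuous_on UNIV (\<lambda>w. f (z + w))"
    by (intro continuous_on_compose2[OF cont] continuous_intros) auto
  then have "integral (cbox 0 (vec T :: real ^ 'n)) (\<lambda>_. l) \<le> integral (cbox 0 (vec T)) (\<lambda>w. f (z + w))"
    using l by (intro integral_le continuous_integrable_cbox) auto
  then show ?thesis
    using vol_vec_cube[of T "0 :: real ^ 'n"] \<open>T > 0\<close> by (simp add: smooth_def field_simps)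
qed

lemma Lipschitz_continuous_on:
  fixes F :: "real ^ 'n \<Rightarrow> real"
  assumes "\<And>z z'. \<bar>F z - F z'\<bar> \<le> B * norm (z - z')"
  shows "continuous_on UNIV F"
proof -
  \<comment> \<open>Testing on a unit vector shows \<open>B \<ge> 0\<close>, which
    \<open>lipschitz_on\<close> requires.\<close>
  have "0 \<le> \<bar>F (axis undefined 1) - F 0\<bar>"
    by simp
  also have "\<dots> \<le> B"
    using assms[of "axis undefined 1" 0] by simp
  finally have "B-lipschitz_on UNIV F"
    using assms by (intro lipschitz_onI) (auto simp: dist_norm)
  then show ?thesis
    by (rule lipschitz_on_continuous_on)
qed

lemma avg_within_mono:
  "avg_within f a T e \<Longrightarrow> T \<le> T' \<Longrightarrow> e \<le> e' \<Longrightarrow> avg_within f a T' e'"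
  unfolding avg_within_def by (auto elim!: avg_ge_mono)

text \<open>Smoothing commutes with unit increments, so \<open>G\<close>, the smoothed function
  minus the linear form, changes by at most \<open>e\<close> per unit step. A walk along the axes
  from 0 to the integer part \<open>v\<close> of \<open>x\<close> takes at most
  \<open>CARD('n) * (norm x + 1)\<close> steps. The errors from rounding \<open>x\<close> and from
  smoothing at both ends are bounded uniformly in \<open>x\<close>.\<close>

lemma displacement_bound:
  fixes F :: "real ^ 'n \<Rightarrow> real"
  assumes lip: "\<And>z z'. \<bar>F z - F z'\<bar> \<le> B * norm (z - z')" and "T > 0"
    and avg: "\<And>j. avg_within (\<lambda>z. F (z + axis j 1) - F z) (a j) T e"
  shows "\<bar>F x - F 0 - (\<Sum>j\<in>UNIV. a j * x $ j)\<bar>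
    \<le> (2 * B * real CARD('n) + (\<Sum>j\<in>UNIV. \<bar>a j\<bar>)) * (1 + T) + real CARD('n) * e * (norm x + 1)"
proof -
  define n where "n = real CARD('n)"
  define L where "L z = (\<Sum>j\<in>UNIV. a j * z $ j)" for z :: "real ^ 'n"
  define G where "G z = smooth T F z - L z" for z
  define s where "s = (\<Sum>j\<in>UNIV. \<bar>a j\<bar>)"
  have cont: "continuous_on UNIV F"
    using lip by (rule Lipschitz_continuous_on)
  have L_add: "L (y + z) = L y + L z" for y z
    by (simp add: L_def distrib_left sum.distrib)
  have L_axis: "L (axis j 1) = a j" for j
    by (simp add: L_def axis_def if_distrib[of "(*) _"] cong: if_cong)
  have "B \<ge> 0"
    using lip[of "axis undefined 1" 0] by simp
  have step: "\<bar>G (z + axis j 1) - G z\<bar> \<le> e" for z j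
  proof -
    have int: "(\<lambda>w. F (y + w)) integrable_on cbox 0 (vec T)" for y
      by (intro continuous_integrable_cbox continuous_on_compose2[OF cont] continuous_intros) auto
    have "integral (cbox 0 (vec T)) (\<lambda>w. F (z + w + axis j 1) - F (z + w))
        = integral (cbox 0 (vec T)) (\<lambda>w. F (z + axis j 1 + w)) - integral (cbox 0 (vec T)) (\<lambda>w. F (z + w))"
      using integral_diff[OF int[of "z + axis j 1"] int[of z]] by (simp add: add_ac)
    then have eq: "smooth T (\<lambda>z. F (z + axis j 1) - F z) z = smooth T F (z + axis j 1) - smooth T F z"
      by (simp add: smooth_def diff_divide_distrib)
    have "a j - e \<le> smooth T (\<lambda>z. F (z + axis j 1) - F z) z"
      using avg[of j] \<open>T > 0\<close> by (intro smooth_ge) (auto simp: avg_within_def)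
    moreover have "- (a j + e) \<le> smooth T (\<lambda>z. - (F (z + axis j 1) - F z)) z"
      using avg[of j] \<open>T > 0\<close> by (intro smooth_ge) (auto simp: avg_within_def)
    ultimately show ?thesis
      unfolding smooth_uminus eq G_def L_add L_axis by (simp add: abs_le_iff)
  qed
  have "e \<ge> 0"
    using step[of 0 undefined] by linarith
  have step_nat: "\<bar>G (z + real k *\<^sub>R axis j 1) - G z\<bar> \<le> real k * e" for z j k
  proof (induction k)
    case (Suc k)
    have "z + real (Suc k) *\<^sub>R axis j 1 = z + real k *\<^sub>R axis j 1 + axis j 1"
      by (simp add: algebra_simps)
    then show ?case
      using Suc step[of "z + real k *\<^sub>R axis j 1" j] by (simp add: algebra_simps)
  qed simp
  have step_int: "\<bar>G (z + of_int m *\<^sub>R axis j 1) - G z\<bar> \<le> of_int \<bar>m\<bar> * e" for z j m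
  proof (cases "m \<ge> 0")
    case True
    then show ?thesis
      using step_nat[of z "nat m" j] by simp
  next
    case False
    have "real (nat (- m)) = - of_int m"
      using False by simp
    then show ?thesis
      using step_nat[of "z + of_int m *\<^sub>R axis j 1" "nat (- m)" j] False by (simp add: abs_minus_commute)
  qed
  have walk: "\<bar>G (\<Sum>j\<in>J. of_int (m j) *\<^sub>R axis j 1) - G 0\<bar> \<le> (\<Sum>j\<in>J. of_int \<bar>m j\<bar> * e)"
    if "finite J" for J m
    using that
  proof induction
    case (insert k J)
    then show ?case
      using step_int[of "\<Sum>j\<in>J. of_int (m j) *\<^sub>R axis j 1" "m k" k] by (simp add: add.commute)
  qed simp
  define v :: "real ^ 'n" where "v = (\<Sum>j\<in>UNIV. of_int \<lfloor>x $ j\<rfloor> *\<^sub>R axis j 1)"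
  have v: "v $ i = of_int \<lfloor>x $ i\<rfloor>" for i
    by (simp add: v_def axis_def if_distrib[of "(*) _"] cong: if_cong)
  have xv: "\<bar>(x - v) $ i\<bar> \<le> 1" for i
    unfolding vector_minus_component v by linarith
  have "norm (x - v) \<le> n"
    using norm_le_card_mult[of "x - v" 1] xv by (simp add: n_def)
  then have 1: "\<bar>F x - F v\<bar> \<le> B * n"
    using lip[of x v] \<open>B \<ge> 0\<close> by (meson mult_left_mono order_trans)
  have 2: "\<bar>smooth T F z - F z\<bar> \<le> B * (n * T)" for z
  proof -
    have near: "\<bar>F (z + w) - F z\<bar> \<le> B * (n * T)" if "w \<in> cbox 0 (vec T)" for w
    proof -
      have "norm w \<le> n * T"
        unfolding n_def using that by (intro norm_le_card_mult) (auto simp: mem_box_cart)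
      then show ?thesis
        using lip[of "z + w" z] \<open>B \<ge> 0\<close> by (simp add: mult_left_mono order_trans)
    qed
    have "F z - B * (n * T) \<le> smooth T F z"
      using near by (intro smooth_ge_pointwise[OF cont \<open>T > 0\<close>]) (force simp: abs_le_iff)
    moreover have "- F z - B * (n * T) \<le> smooth T (\<lambda>x. - F x) z"
      using near cont \<open>T > 0\<close> by (intro smooth_ge_pointwise continuous_intros) (force simp: abs_le_iff)+
    ultimately show ?thesis
      unfolding smooth_uminus by (simp add: abs_le_iff)
  qed
  have 3: "\<bar>G v - G 0\<bar> \<le> n * e * (norm x + 1)"
  proof -
    have "\<bar>G v - G 0\<bar> \<le> (\<Sum>j\<in>(UNIV::'n set). of_int \<bar>\<lfloor>x $ j\<rfloor>\<bar> * e)"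
      unfolding v_def by (rule walk) simp
    also have "\<dots> \<le> (\<Sum>j\<in>(UNIV::'n set). (norm x + 1) * e)"
    proof (intro sum_mono mult_right_mono \<open>e \<ge> 0\<close>)
      fix j
      show "of_int \<bar>\<lfloor>x $ j\<rfloor>\<bar> \<le> norm x + 1"
        using component_le_norm_cart[of x j] by linarith
    qed
    finally show ?thesis
      by (simp add: n_def mult_ac)
  qed
  have 4: "\<bar>L x - L v\<bar> \<le> s"
  proof -
    have "L x - L v = (\<Sum>j\<in>UNIV. a j * (x - v) $ j)"
      by (simp add: L_def right_diff_distrib sum_subtractf)
    also have "\<bar>\<dots>\<bar> \<le> (\<Sum>j\<in>UNIV. \<bar>a j * (x - v) $ j\<bar>)"
      by (rule sum_abs)
    also have "\<dots> \<le> (\<Sum>j\<in>UNIV. \<bar>a j\<bar> * 1)"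
      unfolding abs_mult using xv by (intro sum_mono mult_left_mono) auto
    finally show ?thesis
      by (simp add: s_def)
  qed
  have "L 0 = 0"
    by (simp add: L_def)
  have "\<bar>F x - F 0 - L x\<bar> \<le> B * n + 2 * (B * (n * T)) + s + n * e * (norm x + 1)"
    using 1 2[of v] 2[of 0] 3 4 \<open>L 0 = 0\<close> unfolding G_def by linarith
  also have "\<dots> \<le> (2 * B * n + s) * (1 + T) + n * e * (norm x + 1)"
  proof -
    have "0 \<le> B * n" "0 \<le> s * T"
      using \<open>B \<ge> 0\<close> \<open>T > 0\<close> by (auto simp: n_def s_def intro!: mult_nonneg_nonneg sum_nonneg)
    then show ?thesis
      by (simp add: algebra_simps)
  qed
  finally show ?thesis
    by (simp add: L_def s_def n_def)
qed

text \<open>Equal patches determine the extension only up to the additive constant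
  \<open>f x\<close>. In a unit increment this constant cancels; the range grows by 1 because the
  second point lies one unit further away.\<close>

lemma coherent_increments:
  fixes X :: "(real ^ 'n) set"
  assumes "delone X" "finite_type X" "0 \<in> X" and coh: "translation_coherent X f"
  shows "\<exists>F B \<rho>. (\<forall>x\<in>X. F x = f x) \<and> (\<forall>z z'. \<bar>F z - F z'\<bar> \<le> B * norm (z - z')) \<and>
    (\<forall>j. continuous_on UNIV (\<lambda>z. F (z + axis j 1) - F z) \<and>
      pattern_equivariant X \<rho> (\<lambda>z. F (z + axis j 1) - F z) \<and>
      (\<forall>z. \<bar>F (z + axis j 1) - F z\<bar> \<le> B))"
proof -
  obtain R where R: "R > 0" "\<And>c. \<exists>x\<in>X. norm (x - c) \<le> R"
    using delone_relatively_dense[OF assms(1)] by blast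
  obtain C where C: "C \<ge> 0" "\<And>x y. x \<in> X \<Longrightarrow> y \<in> X \<Longrightarrow> \<bar>f x - f y\<bar> \<le> C * norm (x - y)"
    using translation_coherent_Lipschitz[OF assms(1,2) coh] by blast
  have "X \<noteq> {}"
    using assms(3) by blast
  from translation_coherent_extension[OF this R C coh]
  obtain F \<rho> where F: "\<And>x. x \<in> X \<Longrightarrow> F x = f x"
    and lip: "\<And>z z'. \<bar>F z - F z'\<bar> \<le> (C + 1) * norm (z - z')"
    and loc: "\<And>x x' T w. x \<in> X \<Longrightarrow> x' \<in> X \<Longrightarrow> patch X T x = patch X T x' \<Longrightarrow> norm w + \<rho> \<le> T \<Longrightarrow>
       F (x + w) - f x = F (x' + w) - f x'"
    by blast
  have cont: "continuous_on UNIV F"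
    using lip by (rule Lipschitz_continuous_on)
  have "continuous_on UNIV (\<lambda>z. F (z + axis j 1) - F z)" for j
    by (intro continuous_intros cont continuous_on_compose2[OF cont]) auto
  moreover have "pattern_equivariant X (\<rho> + 1) (\<lambda>z. F (z + axis j 1) - F z)" for j
    unfolding pattern_equivariant_def
  proof (intro ballI allI impI)
    fix x x' T and w :: "real ^ 'n"
    assume x: "x \<in> X" "x' \<in> X" "patch X T x = patch X T x'" and w: "norm w + (\<rho> + 1) \<le> T"
    have "norm (w + axis j 1) + \<rho> \<le> T"
      using norm_triangle_ineq[of w "axis j 1"] w by simp
    moreover have "norm w + \<rho> \<le> T"
      using w by simp
    ultimately show "F (x + w + axis j 1) - F (x + w) = F (x' + w + axis j 1) - F (x' + w)"
      using loc[OF x, of w] loc[OF x, of "w + axis j 1"] by (simp add: add.assoc)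
  qed
  moreover have "\<bar>F (z + axis j 1) - F z\<bar> \<le> C + 1" for j z
    using lip[of "z + axis j 1" z] by simp
  ultimately show ?thesis
    using F lip by blast
qed

lemma coherent_linear_approx_dense:
  fixes X :: "(real ^ 'n) set"
  assumes X: "delone X" "finite_type X" "0 \<in> X" "densely_repetitive X"
    and coh: "translation_coherent X f" and "f 0 = 0"
  shows "\<exists>a. \<forall>e>0. \<exists>c. \<forall>x\<in>X. \<bar>f x - (\<Sum>j\<in>UNIV. a j * x $ j)\<bar> \<le> c + e * norm x"
proof -
  obtain F B \<rho> where FB: "\<forall>x\<in>X. F x = f x" "\<forall>z z'. \<bar>F z - F z'\<bar> \<le> B * norm (z - z')"
    "\<forall>j. continuous_on UNIV (\<lambda>z. F (z + axis j 1) - F z) \<and>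
      pattern_equivariant X \<rho> (\<lambda>z. F (z + axis j 1) - F z) \<and>
      (\<forall>z. \<bar>F (z + axis j 1) - F z\<bar> \<le> B)"
    using coherent_increments[OF X(1-3) coh] by blast
  note F = FB(1)[rule_format] and lip = FB(2)[rule_format]
  have inc: "continuous_on UNIV (\<lambda>z. F (z + axis j 1) - F z)"
    "pattern_equivariant X \<rho> (\<lambda>z. F (z + axis j 1) - F z)"
    "\<bar>F (z + axis j 1) - F z\<bar> \<le> B" for j z
    using FB(3) by blast+
  have "\<exists>b. \<forall>e>0. \<exists>T>0. avg_within (\<lambda>z. F (z + axis j 1) - F z) b T e" for j
    using densely_repetitive_averages[OF X inc] .
  then obtain a where a: "\<And>j e. e > 0 \<Longrightarrow> \<exists>T>0. avg_within (\<lambda>z. F (z + axis j 1) - F z) (a j) T e"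
    by metis
  have "\<exists>c. \<forall>x\<in>X. \<bar>f x - (\<Sum>j\<in>UNIV. a j * x $ j)\<bar> \<le> c + e * norm x" if "e > 0" for e
  proof -
    \<comment> \<open>Compensates the factor \<open>CARD('n)\<close> with which the averaging error
      enters the displacement bound.\<close>
    define e' where "e' = e / real CARD('n)"
    have "e' > 0"
      using that by (simp add: e'_def)
    then obtain t where t: "\<And>j. t j > 0" "\<And>j. avg_within (\<lambda>z. F (z + axis j 1) - F z) (a j) (t j) e'"
      using a by metis
    \<comment> \<open>The sum of the scales exceeds each \<open>t j\<close> and serves all
      directions at once.\<close>
    define T where "T = (\<Sum>j\<in>UNIV. t j)"
    have tT: "t j \<le> T" for j
      unfolding T_def using t(1) by (intro member_le_sum) (auto intro: less_imp_le)
    then have "T > 0"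
      using t(1) by (meson less_le_trans)
    have avg: "avg_within (\<lambda>z. F (z + axis j 1) - F z) (a j) T e'" for j
      using t(2) tT order_refl by (rule avg_within_mono)
    define c where "c = (2 * B * real CARD('n) + (\<Sum>j\<in>UNIV. \<bar>a j\<bar>)) * (1 + T) + e"
    have "\<bar>f x - (\<Sum>j\<in>UNIV. a j * x $ j)\<bar> \<le> c + e * norm x" if "x \<in> X" for x
      using displacement_bound[OF lip \<open>T > 0\<close> avg, of x] F[OF that] F[OF X(3)] \<open>f 0 = 0\<close>
      by (simp add: c_def e'_def algebra_simps)
    then show ?thesis
      by blast
  qed
  then show ?thesis
    by blast
qed

lemma linear_approx_rate:
  fixes X :: "(real ^ 'n) set"
  assumes X: "delone X" "finite_type X" "0 \<in> X" "linearly_repetitive X"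
  shows "\<exists>\<delta>>0. \<forall>f. translation_coherent X f \<longrightarrow> f 0 = 0 \<longrightarrow>
    (\<exists>a c b. \<forall>x\<in>X. b \<le> norm x \<longrightarrow> \<bar>f x - (\<Sum>j\<in>UNIV. a j * x $ j)\<bar> \<le> c * norm x powr (1 - \<delta>))"
proof -
  obtain \<delta>0 where "\<delta>0 > 0" and avg0: "\<forall>f \<rho> C. continuous_on UNIV f \<longrightarrow> pattern_equivariant X \<rho> f \<longrightarrow>
      (\<forall>x. \<bar>f x\<bar> \<le> C) \<longrightarrow> (\<exists>a c T0. T0 > 0 \<and> (\<forall>T\<ge>T0. avg_within f a T (c * T powr (- \<delta>0))))"
    using linearly_repetitive_averages[OF X] by (elim exE conjE)
  have avg: "\<exists>a c T0. T0 > 0 \<and> (\<forall>T\<ge>T0. avg_within f a T (c * T powr (- \<delta>0)))"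
    if "continuous_on UNIV f" "pattern_equivariant X \<rho> f" "\<And>x. \<bar>f x\<bar> \<le> C" for f \<rho> C
    using avg0[rule_format, OF that] .
  \<comment> \<open>With \<open>T\<close> the square root of \<open>norm x\<close>, the term linear
    in \<open>T\<close> has order \<open>norm x powr (1 / 2)\<close> and the averaging term has
    order \<open>norm x powr (1 - \<delta>0 / 2)\<close>; the minimum covers both.\<close>
  define \<delta> where "\<delta> = min (1 / 2) (\<delta>0 / 2)"
  have \<delta>: "\<delta> > 0" "\<delta> \<le> 1 / 2" "\<delta> \<le> \<delta>0 / 2"
    using \<open>\<delta>0 > 0\<close> by (auto simp: \<delta>_def)
  have "\<exists>a c b. \<forall>x\<in>X. b \<le> norm x \<longrightarrow> \<bar>f x - (\<Sum>j\<in>UNIV. a j * x $ j)\<bar> \<le> c * norm x powr (1 - \<delta>)"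
    if coh: "translation_coherent X f" and "f 0 = 0" for f
  proof -
    obtain F B \<rho> where FB: "\<forall>x\<in>X. F x = f x" "\<forall>z z'. \<bar>F z - F z'\<bar> \<le> B * norm (z - z')"
      "\<forall>j. continuous_on UNIV (\<lambda>z. F (z + axis j 1) - F z) \<and>
        pattern_equivariant X \<rho> (\<lambda>z. F (z + axis j 1) - F z) \<and>
        (\<forall>z. \<bar>F (z + axis j 1) - F z\<bar> \<le> B)"
      using coherent_increments[OF X(1-3) coh] by blast
    note F = FB(1)[rule_format] and lip = FB(2)[rule_format]
    have inc: "continuous_on UNIV (\<lambda>z. F (z + axis j 1) - F z)"
      "pattern_equivariant X \<rho> (\<lambda>z. F (z + axis j 1) - F z)"
      "\<bar>F (z + axis j 1) - F z\<bar> \<le> B" for j z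
      using FB(3) by blast+
    have "\<exists>a c T0. T0 > 0 \<and> (\<forall>T\<ge>T0. avg_within (\<lambda>z. F (z + axis j 1) - F z) a T (c * T powr (- \<delta>0)))" for j
      using avg[OF inc] .
    then obtain a c t where t: "\<And>j. t j > 0"
      "\<And>j T. t j \<le> T \<Longrightarrow> avg_within (\<lambda>z. F (z + axis j 1) - F z) (a j) T (c j * T powr (- \<delta>0))"
      by metis
    define cm where "cm = (\<Sum>j\<in>UNIV. \<bar>c j\<bar>)"
    define tm where "tm = (\<Sum>j\<in>UNIV. t j)"
    define A where "A = 2 * B * real CARD('n) + (\<Sum>j\<in>UNIV. \<bar>a j\<bar>)"
    have tm: "t j \<le> tm" for j
      unfolding tm_def using t(1) by (intro member_le_sum) (auto intro: less_imp_le)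
    have cm: "c j \<le> cm" for j
      unfolding cm_def using member_le_sum[of j UNIV "\<lambda>j. \<bar>c j\<bar>"] abs_ge_self[of "c j"] by fastforce
    have "cm \<ge> 0"
      by (simp add: cm_def sum_nonneg)
    have "B \<ge> 0"
      using lip[of "axis undefined 1" 0] by simp
    then have "A \<ge> 0"
      by (simp add: A_def sum_nonneg)
    \<comment> \<open>The threshold gives \<open>1 \<le> norm x\<close> and places the square root
      of \<open>norm x\<close> above every starting scale \<open>t j\<close>.\<close>
    have "\<bar>f x - (\<Sum>j\<in>UNIV. a j * x $ j)\<bar> \<le> (2 * A + 2 * real CARD('n) * cm) * norm x powr (1 - \<delta>)"
      if x: "x \<in> X" "max 1 (tm ^ 2) \<le> norm x" for x
    proof -
      define N where "N = norm x"
      define T where "T = sqrt N"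
      have "N \<ge> 1" "tm \<le> T"
        using x(2) by (auto simp: N_def T_def intro: real_le_rsqrt)
      then have "T \<ge> 1"
        by (simp add: T_def)
      have avgT: "avg_within (\<lambda>z. F (z + axis j 1) - F z) (a j) T (cm * T powr (- \<delta>0))" for j
        using t(2)[of j T] tm[of j] \<open>tm \<le> T\<close> cm[of j]
        by (intro avg_within_mono[OF t(2)[of j T] order_refl] mult_right_mono) auto
      have "\<bar>f x - (\<Sum>j\<in>UNIV. a j * x $ j)\<bar> \<le> A * (1 + T) + real CARD('n) * (cm * T powr (- \<delta>0)) * (N + 1)"
        using displacement_bound[OF lip _ avgT, of x] \<open>T \<ge> 1\<close> F[OF x(1)] F[OF X(3)] \<open>f 0 = 0\<close>
        by (simp add: A_def N_def)
      also have "\<dots> \<le> A * (2 * N powr (1 - \<delta>)) + real CARD('n) * cm * (2 * N powr (1 - \<delta>))"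
      proof (rule add_mono)
        have "T = N powr (1 / 2)"
          using \<open>N \<ge> 1\<close> by (simp add: T_def powr_half_sqrt)
        also have "\<dots> \<le> N powr (1 - \<delta>)"
          using \<open>N \<ge> 1\<close> \<delta> by (intro powr_mono) auto
        finally show "A * (1 + T) \<le> A * (2 * N powr (1 - \<delta>))"
          using \<open>A \<ge> 0\<close> \<open>T \<ge> 1\<close> by (intro mult_left_mono) auto
        have "T powr (- \<delta>0) * N = N powr (- (\<delta>0 / 2)) * N powr 1"
          using \<open>N \<ge> 1\<close> by (simp add: T_def powr_half_sqrt[symmetric] powr_powr)
        also have "\<dots> = N powr (1 - \<delta>0 / 2)"
          unfolding powr_add[symmetric] by simp
        also have "\<dots> \<le> N powr (1 - \<delta>)"
          using \<open>N \<ge> 1\<close> \<delta> by (intro powr_mono) auto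
        finally have "T powr (- \<delta>0) * N \<le> N powr (1 - \<delta>)" .
        moreover have "T powr (- \<delta>0) * (N + 1) \<le> T powr (- \<delta>0) * (2 * N)"
          using \<open>N \<ge> 1\<close> by (intro mult_left_mono) auto
        ultimately have "T powr (- \<delta>0) * (N + 1) \<le> 2 * N powr (1 - \<delta>)"
          by linarith
        then have "real CARD('n) * cm * (T powr (- \<delta>0) * (N + 1)) \<le> real CARD('n) * cm * (2 * N powr (1 - \<delta>))"
          using \<open>cm \<ge> 0\<close> by (intro mult_left_mono) auto
        then show "real CARD('n) * (cm * T powr (- \<delta>0)) * (N + 1) \<le> real CARD('n) * cm * (2 * N powr (1 - \<delta>))"
          by (simp add: mult.assoc)
      qed
      finally show ?thesis
        by (simp add: N_def algebra_simps)
    qed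
    then show ?thesis
      by blast
  qed
  then show ?thesis
    using \<delta>(1) by blast
qed

section \<open>Address maps\<close>

text \<open>\<open>\<phi>\<close> is prescribed only on integer combinations of the basis, so points
  of \<open>X\<close> are expanded in it. The prescription reads off the coefficients, hence
  \<open>\<phi> (x - z) = \<phi> x - \<phi> z\<close> on \<open>X\<close>, and equal differences
  give equal increments.\<close>

lemma address_map_coherent:
  fixes \<phi> :: "real ^ 'n \<Rightarrow> int ^ 's" and X :: "(real ^ 'n) set"
  assumes "address_map (group_closure X) \<phi>"
  shows "translation_coherent X (\<lambda>x. real_of_int (\<phi> x $ i))" and "\<phi> 0 = 0"
proof -
  obtain y :: "'s \<Rightarrow> real ^ 'n" where y: "inj y" "int_module.span (range y) = group_closure X"
    and \<phi>: "\<And>m :: int ^ 's. \<phi> (\<Sum>i\<in>UNIV. int_scale (m $ i) (y i)) = m"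
    using assms by (auto simp: address_map_def int_basis_def)
  have rep: "x = (\<Sum>i\<in>UNIV. int_scale (\<phi> x $ i) (y i))" if "x \<in> X" for x
  proof -
    have "x \<in> int_module.span (range y)"
      using that y(2) by (auto intro: group_closure.base)
    then obtain u where u: "x = (\<Sum>v\<in>range y. int_scale (u v) v)"
      by (auto simp: int_module.span_finite)
    also have "\<dots> = (\<Sum>i\<in>UNIV. int_scale (u (y i)) (y i))"
      using y(1) by (simp add: sum.reindex)
    finally have x: "x = (\<Sum>i\<in>UNIV. int_scale ((\<chi> i. u (y i)) $ i) (y i))"
      by simp
    then have "\<phi> x = (\<chi> i. u (y i))"
      using \<phi> by metis
    then show ?thesis
      using x by simp
  qed
  have diff: "\<phi> (x - z) = \<phi> x - \<phi> z" if "x \<in> X" "z \<in> X" for x z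
  proof -
    have "x - z = (\<Sum>i\<in>UNIV. int_scale (\<phi> x $ i) (y i)) - (\<Sum>i\<in>UNIV. int_scale (\<phi> z $ i) (y i))"
      using rep that by metis
    also have "\<dots> = (\<Sum>i\<in>UNIV. int_scale ((\<phi> x - \<phi> z) $ i) (y i))"
      by (simp add: sum_subtractf int_module.scale_left_diff_distrib)
    finally show ?thesis
      using \<phi> by metis
  qed
  then show "translation_coherent X (\<lambda>x. real_of_int (\<phi> x $ i))"
    unfolding translation_coherent_def of_int_diff[symmetric] vector_minus_component[symmetric]
    by metis
  show "\<phi> 0 = 0"
    using \<phi>[of 0] by (simp add: int_scale_def)
qed

section \<open>Passage to Landau estimates at infinity within \<open>X\<close>\<close>

lemma eventually_at_infinity_in:
  assumes "\<And>x. x \<in> X \<Longrightarrow> b \<le> norm x \<Longrightarrow> P x"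
  shows "eventually P (at_infinity_in X)"
  using assms by (auto simp: at_infinity_in_def eventually_inf_principal eventually_at_infinity)

lemma norm_powr_smallo:
  assumes "\<delta> > 0"
  shows "(\<lambda>x. norm x powr (1 - \<delta>)) \<in> o[at_infinity_in X](\<lambda>x. norm x)"
proof (rule landau_o.smallI)
  fix c :: real assume "c > 0"
  \<comment> \<open>From the threshold on, \<open>t powr \<delta>\<close> is at least
    \<open>1 / c\<close>; the \<open>max\<close> with 1 keeps \<open>t\<close> positive.\<close>
  have small: "t powr (1 - \<delta>) \<le> c * t" if "t \<ge> max 1 ((1 / c) powr (1 / \<delta>))" for t
  proof -
    have "((1 / c) powr (1 / \<delta>)) powr \<delta> \<le> t powr \<delta>"
      using that \<open>\<delta> > 0\<close> by (intro powr_mono2) auto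
    then have "1 \<le> c * t powr \<delta>"
      using \<open>c > 0\<close> \<open>\<delta> > 0\<close> by (simp add: powr_powr field_simps)
    then have "1 * t powr (1 - \<delta>) \<le> c * t powr \<delta> * t powr (1 - \<delta>)"
      by (intro mult_right_mono) auto
    also have "\<dots> = c * t"
      using that by (simp add: powr_add[symmetric])
    finally show ?thesis
      by simp
  qed
  show "\<forall>\<^sub>F x in at_infinity_in X. norm (norm x powr (1 - \<delta>)) \<le> c * norm (norm x)"
    by (rule eventually_at_infinity_in[where b = "max 1 ((1 / c) powr (1 / \<delta>))"]) (simp add: small)
qed

lemma norm_address_diff_le:
  fixes m :: "int ^ 's" and x :: "real ^ 'n"
  shows "norm (real_of_int_vec m - (\<chi> i. \<Sum>j\<in>UNIV. a i j * x $ j))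
    \<le> (\<Sum>i\<in>UNIV. \<bar>real_of_int (m $ i) - (\<Sum>j\<in>UNIV. a i j * x $ j)\<bar>)"
  using norm_le_l1_cart[of "real_of_int_vec m - (\<chi> i. \<Sum>j\<in>UNIV. a i j * x $ j)"]
  by (simp add: real_of_int_vec_def)

lemma linear_matrix_sum: "linear (\<lambda>x :: real ^ 'n. (\<chi> i. \<Sum>j\<in>UNIV. a i j * x $ j) :: real ^ 's)"
  by (rule linearI) (auto simp: vec_eq_iff distrib_left sum.distrib sum_distrib_left mult_ac)

text \<open>\<open>\<delta>\<close> is quantified before \<open>\<phi>\<close> because the exponent
  may depend on \<open>X\<close> but not on the choice of basis. In the linearly repetitive case the
  rate already implies the little-o bound.\<close>

theorem theorem7p1:
  fixes X :: "(real ^ 'n) set"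
  assumes "delone X" and "finite_type X" and "0 \<in> X"
    and "has_int_rank (group_closure X) CARD('s::finite)"
    and "has_int_rank (group_closure (difference_set X)) CARD('s)"
    and "linearly_repetitive X \<or> densely_repetitive X"
  shows "\<exists>\<delta>>0. \<forall>\<phi> :: real ^ 'n \<Rightarrow> int ^ 's. address_map (group_closure X) \<phi> \<longrightarrow>
    (\<exists>L :: real ^ 'n \<Rightarrow> real ^ 's. linear L \<and>
       (\<lambda>x. norm (real_of_int_vec (\<phi> x) - L x)) \<in> o[at_infinity_in X](\<lambda>x. norm x) \<and>
       (linearly_repetitive X \<longrightarrow>
          (\<lambda>x. norm (real_of_int_vec (\<phi> x) - L x))
            \<in> O[at_infinity_in X](\<lambda>x. norm x powr (1 - \<delta>))))"
proof (cases "linearly_repetitive X")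
  case True
  obtain \<delta> where "\<delta> > 0" and \<delta>: "\<And>f. translation_coherent X f \<Longrightarrow> f 0 = 0 \<Longrightarrow>
    (\<exists>a c b. \<forall>x\<in>X. b \<le> norm x \<longrightarrow> \<bar>f x - (\<Sum>j\<in>UNIV. a j * x $ j)\<bar> \<le> c * norm x powr (1 - \<delta>))"
    using linear_approx_rate[OF assms(1-3) True] by blast
  have "\<exists>L. linear L \<and>
      (\<lambda>x. norm (real_of_int_vec (\<phi> x) - L x)) \<in> O[at_infinity_in X](\<lambda>x. norm x powr (1 - \<delta>))"
    if "address_map (group_closure X) \<phi>" for \<phi> :: "real ^ 'n \<Rightarrow> int ^ 's"
  proof -
    have "\<exists>a c b. \<forall>x\<in>X. b \<le> norm x \<longrightarrow>
        \<bar>real_of_int (\<phi> x $ i) - (\<Sum>j\<in>UNIV. a j * x $ j)\<bar> \<le> c * norm x powr (1 - \<delta>)" for i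
      using address_map_coherent[OF that] by (intro \<delta>) auto
    then obtain a c b where abc: "\<And>i x. x \<in> X \<Longrightarrow> b i \<le> norm x \<Longrightarrow>
        \<bar>real_of_int (\<phi> x $ i) - (\<Sum>j\<in>UNIV. a i j * x $ j)\<bar> \<le> c i * norm x powr (1 - \<delta>)"
      by metis
    define L :: "real ^ 'n \<Rightarrow> real ^ 's" where "L x = (\<chi> i. \<Sum>j\<in>UNIV. a i j * x $ j)" for x
    have "norm (real_of_int_vec (\<phi> x) - L x) \<le> (\<Sum>i\<in>UNIV. c i) * norm x powr (1 - \<delta>)"
      if x: "x \<in> X" "(\<Sum>i\<in>UNIV. \<bar>b i\<bar>) \<le> norm x" for x
    proof -
      have "b i \<le> norm x" for i
        using x(2) member_le_sum[of i UNIV "\<lambda>i. \<bar>b i\<bar>"] abs_ge_self[of "b i"] by fastforce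
      then have "(\<Sum>i\<in>UNIV. \<bar>real_of_int (\<phi> x $ i) - (\<Sum>j\<in>UNIV. a i j * x $ j)\<bar>)
          \<le> (\<Sum>i\<in>UNIV. c i * norm x powr (1 - \<delta>))"
        using abc[OF x(1)] by (intro sum_mono) blast
      then show ?thesis
        using norm_address_diff_le[of "\<phi> x" a x] by (simp add: L_def sum_distrib_right)
    qed
    then have "(\<lambda>x. norm (real_of_int_vec (\<phi> x) - L x)) \<in> O[at_infinity_in X](\<lambda>x. norm x powr (1 - \<delta>))"
      by (intro bigoI[where c = "\<Sum>i\<in>UNIV. c i"] eventually_at_infinity_in[where b = "\<Sum>i\<in>UNIV. \<bar>b i\<bar>"]) simp
    moreover have "linear L"
      unfolding L_def by (rule linear_matrix_sum)
    ultimately show ?thesis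
      by blast
  qed
  note approx = this
  show ?thesis
  proof (rule exI[of _ \<delta>], intro conjI allI impI)
    fix \<phi> :: "real ^ 'n \<Rightarrow> int ^ 's"
    assume "address_map (group_closure X) \<phi>"
    then obtain L where L: "linear L"
      "(\<lambda>x. norm (real_of_int_vec (\<phi> x) - L x)) \<in> O[at_infinity_in X](\<lambda>x. norm x powr (1 - \<delta>))"
      using approx by blast
    then show "\<exists>L. linear L \<and>
       (\<lambda>x. norm (real_of_int_vec (\<phi> x) - L x)) \<in> o[at_infinity_in X](\<lambda>x. norm x) \<and>
       (linearly_repetitive X \<longrightarrow>
          (\<lambda>x. norm (real_of_int_vec (\<phi> x) - L x))
            \<in> O[at_infinity_in X](\<lambda>x. norm x powr (1 - \<delta>)))"
      using landau_o.big_small_trans[OF L(2) norm_powr_smallo[OF \<open>\<delta> > 0\<close>]] by blast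
  qed (fact \<open>\<delta> > 0\<close>)
next
  case False
  then have dense: "densely_repetitive X"
    using assms(6) by blast
  have "\<exists>L. linear L \<and> (\<lambda>x. norm (real_of_int_vec (\<phi> x) - L x)) \<in> o[at_infinity_in X](\<lambda>x. norm x)"
    if "address_map (group_closure X) \<phi>" for \<phi> :: "real ^ 'n \<Rightarrow> int ^ 's"
  proof -
    have "\<exists>a. \<forall>e>0. \<exists>c. \<forall>x\<in>X. \<bar>real_of_int (\<phi> x $ i) - (\<Sum>j\<in>UNIV. a j * x $ j)\<bar> \<le> c + e * norm x" for i
      using address_map_coherent[OF that] by (intro coherent_linear_approx_dense[OF assms(1-3) dense]) auto
    then obtain a where a: "\<And>i e. e > 0 \<Longrightarrow>
        \<exists>c. \<forall>x\<in>X. \<bar>real_of_int (\<phi> x $ i) - (\<Sum>j\<in>UNIV. a i j * x $ j)\<bar> \<le> c + e * norm x"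
      by metis
    define L :: "real ^ 'n \<Rightarrow> real ^ 's" where "L x = (\<chi> i. \<Sum>j\<in>UNIV. a i j * x $ j)" for x
    have "(\<lambda>x. norm (real_of_int_vec (\<phi> x) - L x)) \<in> o[at_infinity_in X](\<lambda>x. norm x)"
    proof (rule landau_o.smallI)
      fix e :: real assume "e > 0"
      \<comment> \<open>Half of \<open>e\<close> pays for the slopes of all coordinates; the other
        half absorbs the constants \<open>c i\<close> once \<open>norm x\<close> is large.\<close>
      define e' where "e' = e / (2 * real CARD('s))"
      have "e' > 0"
        using \<open>e > 0\<close> by (simp add: e'_def)
      then obtain c where c: "\<And>i x. x \<in> X \<Longrightarrow>
          \<bar>real_of_int (\<phi> x $ i) - (\<Sum>j\<in>UNIV. a i j * x $ j)\<bar> \<le> c i + e' * norm x"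
        using a by metis
      have "norm (real_of_int_vec (\<phi> x) - L x) \<le> e * norm x"
        if x: "x \<in> X" "2 * (\<Sum>i\<in>UNIV. c i) / e \<le> norm x" for x
      proof -
        have "norm (real_of_int_vec (\<phi> x) - L x) \<le> (\<Sum>i\<in>UNIV. c i + e' * norm x)"
          unfolding L_def using c[OF x(1)] by (intro order_trans[OF norm_address_diff_le] sum_mono)
        also have "\<dots> = (\<Sum>i\<in>UNIV. c i) + e * norm x / 2"
          by (simp add: sum.distrib e'_def)
        also have "\<dots> \<le> e * norm x"
          using x(2) \<open>e > 0\<close> by (simp add: field_simps)
        finally show ?thesis .
      qed
      then show "\<forall>\<^sub>F x in at_infinity_in X. norm (norm (real_of_int_vec (\<phi> x) - L x)) \<le> e * norm (norm x)"
        by (intro eventually_at_infinity_in[where b = "2 * (\<Sum>i\<in>UNIV. c i) / e"]) simp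
    qed
    moreover have "linear L"
      unfolding L_def by (rule linear_matrix_sum)
    ultimately show ?thesis
      by blast
  qed
  \<comment> \<open>The rate is demanded only under linear repetitivity, which fails in this case,
    so any positive \<open>\<delta>\<close> will do; 1 is taken.\<close>
  then show ?thesis
    using False zero_less_one by blast
qed

end
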